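(* There is a constant $C$ independent of $\varepsilon$ such that for all $\varepsilon\in(0,1/2]$ the solution $u^\varepsilon$ satisfies $$\|u^\varepsilon_x\|_{L^4((0,\infty);L^\infty(\Omega))}\le C .$$
   Context: Let $\Omega\subset\mathbb R$ be a bounded open interval, $n\in(0,3)$, and $u_{in}\in H^1(\Omega)$ with $u_{in}\ge 0$, $\int_\Omega u_{in}\,dx=1$. For $\varepsilon\in(0,1/2]$ the thin film problem is $|\ln\varepsilon|^{-1}\partial_t u+\partial_x\big((\varepsilon^{3-n}u^n+u^3)\partial_{xxx}u\big)=0$ in $(0,\infty)\times\Omega$, with $(\varepsilon^{3-n}u^n+u^3)u_{xxx}=0$ and $u_x=0$ on $(0,\infty)\times\partial\Omega$, and $u(0,\cdot)=u_{in}$. (Weak form: $|\ln\varepsilon|^{-1}\big(\int_0^\infty\!\int_\Omega u\psi_t+\int_\Omega u_{in}\psi(0,\cdot)\big)+\iint_{\{u>0\}}(\varepsilon^{3-n}u^n+u^3)u_{xxx}\psi_x=0$ for all $\psi\in C_c^\infty([0,\infty)\times\overline\Omega)$.) Let $B(s)=\int_0^s\int_r^\infty\frac{1}{v^{n-1}+v^2}\,dv\,dr$ and $B^\varepsilon(s)=|\ln\varepsilon|^{-1}B(s/\varepsilon)$. For each $\varepsilon$, $u^\varepsilon$ denotes a fixed continuous non-negative weak solution such that, with $\rho^\varepsilon:=B^\varepsilon(u^\varepsilon)$, for every $T>0$: (i) $u^\varepsilon\in L^\infty((0,T);H^1(\Omega))$, $u^\varepsilon u^\varepsilon_{xxx}\in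 L^2((0,T)\times\Omega)$; (ii) $\int_\Omega u^\varepsilon(t)\,dx=\int_\Omega u_{in}\,dx$ for all $t>0$; (iii) $\frac12\int_\Omega|u^\varepsilon_x(t)|^2dx+\int_0^t\int_{\{u^\varepsilon>0\}}|\ln\varepsilon|(\varepsilon^{3-n}(u^\varepsilon)^n+(u^\varepsilon)^3)|u^\varepsilon_{xxx}|^2dx\,ds\le\frac12\int_\Omega|\partial_xu_{in}|^2dx$ for all $t>0$; (iv) $\int_\Omega\rho^\varepsilon(t)\,dx\ge\int_0^t\int_\Omega u^\varepsilon|u^\varepsilon_{xx}|^2dx\,ds+\int_\Omega\rho^\varepsilon(0)\,dx$ for all $t>0$ (with $u^\varepsilon|u^\varepsilon_{xx}|^2:=0$ on $\{u^\varepsilon=0\}$); (v) $u^\varepsilon\in L^2((0,T);H^2(\Omega))$ if $n<2$, and $(u^\varepsilon)^{3/2}\in L^2((0,T);H^2(\Omega))$, $((u^\varepsilon)^{3/4})_x\in L^4((0,T)\times\Omega)$ if $n\ge2$; for a.e. $t$, $u^\varepsilon(t,\cdot)\in C^1(\overline\Omega)$ with $u^\varepsilon_x=0$ on $\partial\Omega$. *)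

theory Defs
  imports "HOL-Probability.Essential_Supremum"
begin

text \<open>
  Functions of time and space are curried, \<open>u t x\<close>.  Elements of Lebesgue and Sobolev spaces are
  given by Borel representatives, and \<open>L\<^sup>p\<close> quantities are \<open>ennreal\<close>-valued integrals, so that
  finiteness is an explicit condition.
\<close>

section \<open>Test functions and weak derivatives\<close>

definition test_fun :: "real set \<Rightarrow> (real \<Rightarrow> real) \<Rightarrow> bool" where
  "test_fun U \<phi> \<longleftrightarrow>
     (\<forall>k x. (deriv ^^ k) \<phi> differentiable (at x)) \<and>
     compact (closure {x. \<phi> x \<noteq> 0}) \<and> closure {x. \<phi> x \<noteq> 0} \<subseteq> U"

text \<open>\<open>D i j\<close> is the partial derivative of order \<open>i\<close> in \<open>t\<close> and \<open>j\<close> in \<open>x\<close>.\<close>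

definition smooth_plane :: "(real \<Rightarrow> real \<Rightarrow> real) \<Rightarrow> bool" where
  "smooth_plane \<psi> \<longleftrightarrow>
     (\<exists>D :: nat \<Rightarrow> nat \<Rightarrow> real \<Rightarrow> real \<Rightarrow> real. D 0 0 = \<psi> \<and>
        (\<forall>i j. continuous_on UNIV (\<lambda>(t, x). D i j t x) \<and>
           (\<forall>t x. ((\<lambda>s. D i j s x) has_real_derivative D (Suc i) j t x) (at t) \<and>
                  (D i j t has_real_derivative D i (Suc j) t x) (at x))))"

text \<open>
  Functions in \<open>C\<^sub>c\<^sup>\<infinity>([0,\<infinity>) \<times> [a,b])\<close> are the restrictions of these; no vanishing is required at
  \<open>t = 0\<close> or on the lateral boundary.
\<close>

definition test_fun_plane :: "(real \<Rightarrow> real \<Rightarrow> real) \<Rightarrow> bool" where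
  "test_fun_plane \<psi> \<longleftrightarrow> smooth_plane \<psi> \<and> compact (closure {(t::real, x::real). \<psi> t x \<noteq> 0})"

definition locally_integrable :: "real set \<Rightarrow> (real \<Rightarrow> real) \<Rightarrow> bool" where
  "locally_integrable U f \<longleftrightarrow> (\<forall>K. compact K \<and> K \<subseteq> U \<longrightarrow> set_integrable lborel K f)"

definition weak_deriv :: "real set \<Rightarrow> (real \<Rightarrow> real) \<Rightarrow> (real \<Rightarrow> real) \<Rightarrow> bool" where
  "weak_deriv U f g \<longleftrightarrow> locally_integrable U f \<and> locally_integrable U g \<and>
     (\<forall>\<phi>. test_fun U \<phi> \<longrightarrow>
        (LINT x:U|lborel. f x * deriv \<phi> x) = - (LINT x:U|lborel. g x * \<phi> x))"

section \<open>Sobolev and Bochner spaces\<close>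

definition L2_sq :: "real set \<Rightarrow> (real \<Rightarrow> real) \<Rightarrow> ennreal" where
  "L2_sq U f = (\<integral>\<^sup>+x\<in>U. ennreal ((f x)\<^sup>2) \<partial>lborel)"

text \<open>\<open>f \<in> H\<^sup>1(U)\<close> with weak derivative \<open>g\<close>\<close>

definition H1_with_deriv :: "real set \<Rightarrow> (real \<Rightarrow> real) \<Rightarrow> (real \<Rightarrow> real) \<Rightarrow> bool" where
  "H1_with_deriv U f g \<longleftrightarrow> weak_deriv U f g \<and> L2_sq U f < \<infinity> \<and> L2_sq U g < \<infinity>"

definition st_measurable :: "real set \<Rightarrow> real set \<Rightarrow> (real \<Rightarrow> real \<Rightarrow> real) \<Rightarrow> bool" where
  "st_measurable I U f \<longleftrightarrow> (\<lambda>(t, x). f t x) \<in> borel_measurable (restrict_space borel (I \<times> U))"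

text \<open>\<open>f \<in> L\<^sup>\<infinity>((0,T); H\<^sup>1(U))\<close> with weak \<open>x\<close>-derivative \<open>g\<close>\<close>

definition Linf_H1 :: "real \<Rightarrow> real set \<Rightarrow> (real \<Rightarrow> real \<Rightarrow> real) \<Rightarrow> (real \<Rightarrow> real \<Rightarrow> real) \<Rightarrow> bool" where
  "Linf_H1 T U f g \<longleftrightarrow> st_measurable {0<..<T} U f \<and> st_measurable {0<..<T} U g \<and>
     (\<exists>M::real. AE t in lborel. t \<in> {0<..<T} \<longrightarrow>
        weak_deriv U (f t) (g t) \<and> L2_sq U (f t) + L2_sq U (g t) \<le> ennreal M)"

text \<open>\<open>f \<in> L\<^sup>2((0,T); H\<^sup>2(U))\<close>\<close>

definition L2_H2 :: "real \<Rightarrow> real set \<Rightarrow> (real \<Rightarrow> real \<Rightarrow> real) \<Rightarrow> bool" where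
  "L2_H2 T U f \<longleftrightarrow> (\<exists>g h.
     st_measurable {0<..<T} U f \<and> st_measurable {0<..<T} U g \<and> st_measurable {0<..<T} U h \<and>
     (AE t in lborel. t \<in> {0<..<T} \<longrightarrow> weak_deriv U (f t) (g t) \<and> weak_deriv U (g t) (h t)) \<and>
     (\<integral>\<^sup>+t\<in>{0<..<T}. (L2_sq U (f t) + L2_sq U (g t) + L2_sq U (h t)) \<partial>lborel) < \<infinity>)"

text \<open>\<open>\<partial>\<^sub>x f \<in> L\<^sup>4((0,T) \<times> U)\<close>\<close>

definition deriv_L4 :: "real \<Rightarrow> real set \<Rightarrow> (real \<Rightarrow> real \<Rightarrow> real) \<Rightarrow> bool" where
  "deriv_L4 T U f \<longleftrightarrow> (\<exists>g. st_measurable {0<..<T} U f \<and> st_measurable {0<..<T} U g \<and>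
     (AE t in lborel. t \<in> {0<..<T} \<longrightarrow> weak_deriv U (f t) (g t)) \<and>
     (\<integral>\<^sup>+t\<in>{0<..<T}. (\<integral>\<^sup>+x\<in>U. ennreal ((g t x) ^ 4) \<partial>lborel) \<partial>lborel) < \<infinity>)"

text \<open>The norm of \<open>L\<^sup>4((0,\<infinity>); L\<^sup>\<infinity>(U))\<close>\<close>

definition L4_Linf_norm :: "real set \<Rightarrow> (real \<Rightarrow> real \<Rightarrow> real) \<Rightarrow> ennreal" where
  "L4_Linf_norm U f =
     (let I = (\<integral>\<^sup>+t\<in>{0<..}. (esssup (restrict_space lborel U) (\<lambda>x. ennreal \<bar>f t x\<bar>)) ^ 4 \<partial>lborel)
      in if I = \<infinity> then \<infinity> else ennreal (root 4 (enn2real I)))"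

section \<open>The thin film equation\<close>

definition mobility :: "real \<Rightarrow> real \<Rightarrow> real \<Rightarrow> real" where
  "mobility n \<epsilon> s = \<epsilon> powr (3 - n) * s powr n + s ^ 3"

definition B_fun :: "real \<Rightarrow> real \<Rightarrow> real" where
  "B_fun n s = (LINT r:{0<..<s}|lborel. (LINT v:{r<..}|lborel. 1 / (v powr (n - 1) + v\<^sup>2)))"

definition B_eps :: "real \<Rightarrow> real \<Rightarrow> real \<Rightarrow> real" where
  "B_eps n \<epsilon> s = B_fun n (s / \<epsilon>) / \<bar>ln \<epsilon>\<bar>"

definition pos_set :: "real \<Rightarrow> real \<Rightarrow> (real \<Rightarrow> real) \<Rightarrow> real set" where
  "pos_set a b f = {x \<in> {a<..<b}. f x > 0}"

text \<open>
  \<open>ux\<close>, \<open>uxx\<close>, \<open>uxxx\<close> represent the first three weak \<open>x\<close>-derivatives of \<open>u\<close>, taken slice by slice in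
  time: the first on all of \<open>(a,b)\<close>, the other two only where \<open>u > 0\<close>.  For jointly measurable, locally
  integrable representatives this is the same as being distributional derivatives in space-time.
\<close>

definition x_derivatives :: "real \<Rightarrow> real \<Rightarrow> (real \<Rightarrow> real \<Rightarrow> real) \<Rightarrow> (real \<Rightarrow> real \<Rightarrow> real) \<Rightarrow>
    (real \<Rightarrow> real \<Rightarrow> real) \<Rightarrow> (real \<Rightarrow> real \<Rightarrow> real) \<Rightarrow> bool" where
  "x_derivatives a b u ux uxx uxxx \<longleftrightarrow>
     st_measurable {0<..} {a<..<b} ux \<and> st_measurable {0<..} {a<..<b} uxx \<and>
     st_measurable {0<..} {a<..<b} uxxx \<and>
     (\<forall>t>0. weak_deriv {a<..<b} (u t) (ux t)) \<and>
     (AE t in lborel. t > 0 \<longrightarrow>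
        weak_deriv (pos_set a b (u t)) (ux t) (uxx t) \<and>
        weak_deriv (pos_set a b (u t)) (uxx t) (uxxx t))"

definition weak_solution :: "real \<Rightarrow> real \<Rightarrow> real \<Rightarrow> real \<Rightarrow> (real \<Rightarrow> real) \<Rightarrow>
    (real \<Rightarrow> real \<Rightarrow> real) \<Rightarrow> (real \<Rightarrow> real \<Rightarrow> real) \<Rightarrow> bool" where
  "weak_solution n a b \<epsilon> u_in u uxxx \<longleftrightarrow>
     continuous_on ({0..} \<times> {a..b}) (\<lambda>(t, x). u t x) \<and>
     (\<forall>t\<ge>0. \<forall>x\<in>{a..b}. u t x \<ge> 0) \<and>
     (AE x in lborel. x \<in> {a<..<b} \<longrightarrow> u 0 x = u_in x) \<and>
     (\<forall>\<psi>. test_fun_plane \<psi> \<longrightarrow>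
        1 / \<bar>ln \<epsilon>\<bar> *
          ((LINT (t, x):{0<..} \<times> {a<..<b}|lborel. u t x * deriv (\<lambda>s. \<psi> s x) t) +
           (LINT x:{a<..<b}|lborel. u_in x * \<psi> 0 x)) +
        (LINT (t, x):{(t, x). t > 0 \<and> x \<in> pos_set a b (u t)}|lborel.
           mobility n \<epsilon> (u t x) * uxxx t x * deriv (\<psi> t) x) = 0)"

text \<open>\<open>f \<in> C\<^sup>1([a,b])\<close> with vanishing derivative at both end points\<close>

definition C1_Neumann :: "real \<Rightarrow> real \<Rightarrow> (real \<Rightarrow> real) \<Rightarrow> bool" where
  "C1_Neumann a b f \<longleftrightarrow> (\<exists>d. continuous_on {a..b} d \<and>
     (\<forall>x\<in>{a..b}. (f has_real_derivative d x) (at x within {a..b})) \<and> d a = 0 \<and> d b = 0)"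

definition thin_film_solution :: "real \<Rightarrow> real \<Rightarrow> real \<Rightarrow> real \<Rightarrow> (real \<Rightarrow> real) \<Rightarrow> (real \<Rightarrow> real) \<Rightarrow>
    (real \<Rightarrow> real \<Rightarrow> real) \<Rightarrow> (real \<Rightarrow> real \<Rightarrow> real) \<Rightarrow> (real \<Rightarrow> real \<Rightarrow> real) \<Rightarrow> (real \<Rightarrow> real \<Rightarrow> real) \<Rightarrow> bool"
where
  "thin_film_solution n a b \<epsilon> u_in du_in u ux uxx uxxx \<longleftrightarrow>
     x_derivatives a b u ux uxx uxxx \<and>
     weak_solution n a b \<epsilon> u_in u uxxx \<and>
     (\<forall>T>0. Linf_H1 T {a<..<b} u ux \<and>
        (\<integral>\<^sup>+t\<in>{0<..<T}. (\<integral>\<^sup>+x\<in>pos_set a b (u t). ennreal ((u t x * uxxx t x)\<^sup>2) \<partial>lborel) \<partial>lborel) < \<infinity>) \<and>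
     (\<forall>t>0. (LINT x:{a<..<b}|lborel. u t x) = (LINT x:{a<..<b}|lborel. u_in x)) \<and>
     (\<forall>t>0. ennreal (1/2) * L2_sq {a<..<b} (ux t) +
        (\<integral>\<^sup>+s\<in>{0<..<t}. (\<integral>\<^sup>+x\<in>pos_set a b (u s).
           ennreal (\<bar>ln \<epsilon>\<bar> * mobility n \<epsilon> (u s x) * (uxxx s x)\<^sup>2) \<partial>lborel) \<partial>lborel)
        \<le> ennreal (1/2) * L2_sq {a<..<b} du_in) \<and>
     (\<forall>t>0. (\<integral>\<^sup>+x\<in>{a<..<b}. ennreal (B_eps n \<epsilon> (u t x)) \<partial>lborel) \<ge>
        (\<integral>\<^sup>+s\<in>{0<..<t}. (\<integral>\<^sup>+x\<in>pos_set a b (u s). ennreal (u s x * (uxx s x)\<^sup>2) \<partial>lborel) \<partial>lborel) +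
        (\<integral>\<^sup>+x\<in>{a<..<b}. ennreal (B_eps n \<epsilon> (u 0 x)) \<partial>lborel)) \<and>
     (n < 2 \<longrightarrow> (\<forall>T>0. L2_H2 T {a<..<b} u)) \<and>
     (n \<ge> 2 \<longrightarrow> (\<forall>T>0. L2_H2 T {a<..<b} (\<lambda>t x. u t x powr (3/2)) \<and>
                        deriv_L4 T {a<..<b} (\<lambda>t x. u t x powr (3/4)))) \<and>
     (AE t in lborel. t > 0 \<longrightarrow> C1_Neumann a b (u t))"

end

theory Submission
  imports Defs "HOL-Computational_Algebra.Polynomial"
begin

text \<open>
  Only conservation of mass and the energy estimate are needed.  Fix a time and write \<open>v\<close> for the slice,
  \<open>M\<close> for the maximum of \<open>\<bar>v'\<bar>\<close>, \<open>l\<close> for the length of the interval and \<open>m\<close> for the mobility.  After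
  a reflection, \<open>v' = M\<close> at some \<open>\<beta>\<close>; let \<open>\<alpha> < \<beta>\<close> be the last point before \<open>\<beta>\<close> where \<open>v' = M/2\<close>.
  On \<open>[\<alpha>,\<beta>]\<close> the slice is positive, and since \<open>v'\<close> is maximal at \<open>\<beta>\<close>, testing with a tent gives
  \<open>M/2 \<le> \<integral> (x - \<alpha>) \<bar>v'''\<bar>\<close>.  By Cauchy-Schwarz, \<open>M\<^sup>2/4 \<le> J \<integral> m(v) \<bar>v'''\<bar>\<^sup>2\<close> with
  \<open>J = \<integral> (x - \<alpha>)\<^sup>2 / m(v)\<close>.

  As \<open>v' \<ge> M/2\<close> on \<open>[\<alpha>,\<beta>]\<close>, we have \<open>x - \<alpha> \<le> 2 v / M\<close>, so that \<open>J\<close> is at most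
  \<open>8 M\<^sup>-\<^sup>3 \<integral> s\<^sup>2 / m(s) ds\<close> over the range of \<open>v\<close>.  The integrand has the exact antiderivative
  \<open>ln (\<epsilon>\<^sup>p + s\<^sup>p) / p\<close> with \<open>p = 3 - n\<close>, so this is of order \<open>\<bar>ln \<epsilon>\<bar>\<close>, the factor that the
  energy estimate provides.  Hence \<open>M\<^sup>5 \<lesssim> \<bar>ln \<epsilon>\<bar> (1 + M) \<integral> m(v) \<bar>v'''\<bar>\<^sup>2\<close>, which controls \<open>M\<^sup>4\<close> unless
  \<open>M\<close> is small.  If \<open>M \<le> 1/(2 l\<^sup>2)\<close>, the unit mass forces \<open>v \<ge> 1/(2 l)\<close>, \<open>J\<close> is bounded and even
  \<open>M\<^sup>2\<close> is controlled.  Integration in time concludes.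
\<close>

section \<open>Smooth functions\<close>

text \<open>This repeats the first conjunct of \<open>test_fun\<close>, so a smooth function becomes
  a test function once its support is controlled.\<close>

definition smooth :: "(real \<Rightarrow> real) \<Rightarrow> bool" where
  "smooth f \<longleftrightarrow> (\<forall>k x. (deriv ^^ k) f differentiable (at x))"

text \<open>By induction on the order, every iterated derivative stays in \<open>S\<close>.
  Smoothness thus never requires a formula for higher derivatives; one only exhibits a class that
  contains the function and is closed under differentiation.\<close>

lemma smooth_coinduct:
  assumes "f \<in> S" "\<And>g. g \<in> S \<Longrightarrow> (\<exists>g'\<in>S. \<forall>x. (g has_real_derivative g' x) (at x))"
  shows "smooth f"
proof -
  have *: "(deriv ^^ k) f \<in> S" for k
  proof (induction k)
    case (Suc k)
    then obtain g' where g: "g' \<in> S" "\<And>x. ((deriv ^^ k) f has_real_derivative g' x) (at x)"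
      using assms(2) by blast
    then have "deriv ((deriv ^^ k) f) = g'" by (intro ext DERIV_imp_deriv)
    then show ?case using g by simp
  qed (use assms in simp)
  show ?thesis
    unfolding smooth_def
    using assms(2)[OF *] by (meson field_differentiable_def field_differentiable_imp_differentiable)
qed

lemma smooth_has_deriv: "smooth f \<Longrightarrow> (f has_real_derivative deriv f x) (at x)"
  unfolding smooth_def
  by (metis DERIV_deriv_iff_real_differentiable eq_id_iff funpow_0)

lemma smooth_deriv: "smooth f \<Longrightarrow> smooth (deriv f)"
  unfolding smooth_def by (metis comp_apply funpow_Suc_right)

lemma smooth_continuous_on: "smooth f \<Longrightarrow> continuous_on A f"
  by (meson DERIV_continuous_on has_field_derivative_at_within smooth_has_deriv)

lemma smooth_antideriv:
  assumes "smooth f" "\<And>x. (F has_real_derivative f x) (at x)"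
  shows "smooth F"
  by (rule smooth_coinduct[where S = "insert F {g. smooth g}"])
     (use assms smooth_deriv smooth_has_deriv in blast)+

lemma smooth_add:
  assumes "smooth f" "smooth g" shows "smooth (\<lambda>x. f x + g x)"
proof (rule smooth_coinduct)
  show "(\<lambda>x. f x + g x) \<in> {\<lambda>x. f x + g x | f g. smooth f \<and> smooth g}" using assms by blast
next
  fix h assume "h \<in> {\<lambda>x. f x + g x | f g. smooth f \<and> smooth g}"
  then obtain f g where h: "h = (\<lambda>x. f x + g x)" "smooth f" "smooth g" by blast
  then have "\<forall>x. (h has_real_derivative (deriv f x + deriv g x)) (at x)"
    by (auto intro!: derivative_intros smooth_has_deriv)
  then show "\<exists>g'\<in>{\<lambda>x. f x + g x | f g. smooth f \<and> smooth g}. \<forall>x. (h has_real_derivative g' x) (at x)"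
    using smooth_deriv h by (intro bexI[of _ "\<lambda>x. deriv f x + deriv g x"]) auto
qed

text \<open>The inner factor \<alpha> from the chain rule is absorbed into the constant
  \<open>c\<close>; with \<alpha> and \<beta> fixed, the class of such functions is therefore closed
  under differentiation.\<close>

lemma smooth_affine:
  assumes "smooth f" shows "smooth (\<lambda>x. c * f (\<alpha> * x + \<beta>))"
proof (rule smooth_coinduct)
  show "(\<lambda>x. c * f (\<alpha> * x + \<beta>)) \<in> {\<lambda>x. c * f (\<alpha> * x + \<beta>) | c f. smooth f}" using assms by blast
next
  fix h assume "h \<in> {\<lambda>x. c * f (\<alpha> * x + \<beta>) | c f. smooth f}"
  then obtain c f where h: "h = (\<lambda>x. c * f (\<alpha> * x + \<beta>))" "smooth f" by blast
  have "(h has_real_derivative ((c * \<alpha>) * deriv f (\<alpha> * x + \<beta>))) (at x)" for x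
    unfolding h
    by (auto intro!: derivative_eq_intros DERIV_chain2[OF smooth_has_deriv[OF h(2)]])
  then show "\<exists>g'\<in>{\<lambda>x. c * f (\<alpha> * x + \<beta>) | c f. smooth f}. \<forall>x. (h has_real_derivative g' x) (at x)"
    using smooth_deriv h by (intro bexI[of _ "\<lambda>x. (c * \<alpha>) * deriv f (\<alpha> * x + \<beta>)"]) auto
qed

text \<open>A set containing all products of smooth functions that is closed under differentiation, as
  needed for \<open>smooth_coinduct\<close>.\<close>

inductive_set prod_sums :: "(real \<Rightarrow> real) set" where
  mult: "smooth f \<Longrightarrow> smooth g \<Longrightarrow> (\<lambda>x. f x * g x) \<in> prod_sums"
| add: "h \<in> prod_sums \<Longrightarrow> k \<in> prod_sums \<Longrightarrow> (\<lambda>x. h x + k x) \<in> prod_sums"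

lemma smooth_mult:
  assumes "smooth f" "smooth g" shows "smooth (\<lambda>x. f x * g x)"
proof (rule smooth_coinduct)
  show "(\<lambda>x. f x * g x) \<in> prod_sums" using assms by (rule prod_sums.mult)
next
  fix h assume "h \<in> prod_sums"
  then show "\<exists>h'\<in>prod_sums. \<forall>x. (h has_real_derivative h' x) (at x)"
  proof induction
    case (mult f g)
    have "\<forall>x. ((\<lambda>x. f x * g x) has_real_derivative (f x * deriv g x + deriv f x * g x)) (at x)"
      using mult by (auto intro!: derivative_eq_intros smooth_has_deriv)
    moreover have "(\<lambda>x. f x * deriv g x + deriv f x * g x) \<in> prod_sums"
      using mult smooth_deriv by (intro prod_sums.add prod_sums.mult) auto
    ultimately show ?case
      by (intro bexI[of _ "\<lambda>x. f x * deriv g x + deriv f x * g x"])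
  next
    case (add h k)
    then obtain h' k' where "h' \<in> prod_sums" "k' \<in> prod_sums"
      "\<forall>x. (h has_real_derivative h' x) (at x)" "\<forall>x. (k has_real_derivative k' x) (at x)" by blast
    then show ?case
      by (intro bexI[of _ "\<lambda>x. h' x + k' x"]) (auto intro!: derivative_intros prod_sums.add)
  qed
qed

section \<open>A smooth ramp built from exp(-1/x)\<close>

definition flat :: "real poly \<Rightarrow> real \<Rightarrow> real" where
  "flat p x = (if x > 0 then poly p (1 / x) * exp (- (1 / x)) else 0)"

lemma poly_exp_decay: "((\<lambda>y::real. poly r y * exp (- y)) \<longlongrightarrow> 0) at_top"
proof -
  have "((\<lambda>y::real. \<Sum>i\<le>degree r. coeff r i * (y ^ i / exp y)) \<longlongrightarrow> (\<Sum>i\<le>degree r. coeff r i * 0)) at_top"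
    by (intro tendsto_intros tendsto_power_div_exp_0)
  then show ?thesis
    by (simp add: poly_altdef exp_minus field_simps sum_distrib_left sum_divide_distrib)
qed

text \<open>With y = 1/x one has y' = -y^2, so p(y) exp(-y) has the derivative y^2 (p - p')(y)
  exp(-y). The family indexed by polynomials is thus closed under differentiation, as
  \<open>smooth_coinduct\<close> requires. At 0 the exponential beats every polynomial.\<close>

lemma flat_deriv: "(flat p has_real_derivative flat (monom 1 2 * (p - pderiv p)) x) (at x)"
proof -
  consider "x > 0" | "x < 0" | "x = 0" by linarith
  then show ?thesis
  proof cases
    case 1
    have i: "((\<lambda>x. 1 / x) has_real_derivative - (1 / x)\<^sup>2) (at x)"
      using 1 by (auto intro!: derivative_eq_intros simp: power2_eq_square)
    have "((\<lambda>x. poly p (1 / x) * exp (- (1 / x))) has_real_derivative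
        (poly (pderiv p) (1 / x) * - (1 / x)\<^sup>2) * exp (- (1 / x)) +
        (exp (- (1 / x)) * - (- (1 / x)\<^sup>2)) * poly p (1 / x)) (at x)"
      by (intro DERIV_mult DERIV_chain2[OF poly_DERIV i] DERIV_chain2[OF DERIV_exp] DERIV_minus i)
    then have "((\<lambda>x. poly p (1 / x) * exp (- (1 / x))) has_real_derivative
            flat (monom 1 2 * (p - pderiv p)) x) (at x)"
      using 1 by (simp add: flat_def poly_monom algebra_simps)
    then show ?thesis
      by (rule has_field_derivative_transform_within_open[where S = "{0<..}"])
         (use 1 in \<open>auto simp: flat_def\<close>)
  next
    case 2
    have "((\<lambda>_. 0) has_real_derivative flat (monom 1 2 * (p - pderiv p)) x) (at x)"
      using 2 by (simp add: flat_def)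
    then show ?thesis
      by (rule has_field_derivative_transform_within_open[where S = "{..<0}"])
         (use 2 in \<open>auto simp: flat_def\<close>)
  next
    case 3
    \<comment> \<open>The difference quotient p(1/h) exp(-1/h) / h is y p(y) exp(-y) at y = 1/h, and
      \<open>pCons 0 p\<close> is the polynomial y p(y).\<close>
    have "((\<lambda>y. poly (pCons 0 p) y * exp (- y)) \<longlongrightarrow> 0) at_top" by (rule poly_exp_decay)
    then have "((\<lambda>h. poly (pCons 0 p) (inverse h) * exp (- inverse h)) \<longlongrightarrow> 0) (at_right 0)"
      by (rule filterlim_compose[OF _ filterlim_inverse_at_top_right])
    moreover have "\<forall>\<^sub>F h in at_right 0. poly (pCons 0 p) (inverse h) * exp (- inverse h) = flat p h / h"
      using eventually_at_right_less[of "0::real"]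
      by (rule eventually_mono) (simp add: flat_def inverse_eq_divide)
    ultimately have r: "((\<lambda>h. flat p h / h) \<longlongrightarrow> 0) (at_right 0)"
      by (rule Lim_transform_eventually)
    have "\<forall>\<^sub>F h in at_left 0. 0 = flat p h / h"
      by (rule eventually_at_leftI[of "-1"]) (auto simp: flat_def)
    then have "((\<lambda>h. flat p h / h) \<longlongrightarrow> 0) (at_left 0)"
      by (rule Lim_transform_eventually[OF tendsto_const])
    then have "((\<lambda>h. flat p h / h) \<longlongrightarrow> 0) (at 0)" using r by (rule filterlim_split_at)
    moreover have "flat q 0 = 0" for q by (simp add: flat_def)
    ultimately show ?thesis unfolding 3 DERIV_def by simp
  qed
qed

lemma smooth_flat: "smooth (flat p)"
proof (rule smooth_coinduct)
  show "flat p \<in> range flat" by simp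
next
  fix g assume "g \<in> range flat"
  then obtain p where "g = flat p" by blast
  then show "\<exists>g'\<in>range flat. \<forall>x. (g has_real_derivative g' x) (at x)"
    using flat_deriv by (intro bexI[of _ "flat (monom 1 2 * (p - pderiv p))"]) auto
qed

lemma smooth_antideriv_exists:
  assumes "smooth f" "\<And>x. x \<le> 0 \<Longrightarrow> f x = 0"
  obtains F where "smooth F" "\<And>x. (F has_real_derivative f x) (at x)" "\<And>x. x \<le> 0 \<Longrightarrow> F x = 0"
proof -
  define F where "F x = integral {0..x} f" for x
  have F0: "F x = 0" if "x \<le> 0" for x
    using that by (cases "x = 0") (auto simp: F_def)
  \<comment> \<open>Moving the base point to -1 changes no value, since \<open>f\<close> vanishes on
    the left half-line, and makes 0 an interior point. The fundamental theorem then gives a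
    two-sided derivative there.\<close>
  have F1: "F x = integral {-1..x} f" if "x \<ge> -1" for x
  proof (cases "x \<ge> 0")
    case True
    have "integral {-1..0} f + integral {0..x} f = integral {-1..x} f"
      by (rule Henstock_Kurzweil_Integration.integral_combine)
         (use True integrable_continuous_interval smooth_continuous_on[OF assms(1)] in auto)
    moreover have "integral {-1..0} f = integral {-1..0::real} (\<lambda>x. 0::real)"
      by (rule Henstock_Kurzweil_Integration.integral_cong) (use assms in auto)
    ultimately show ?thesis by (simp add: F_def)
  next
    case False
    have "integral {-1..x} f = integral {-1..x} (\<lambda>x. 0::real)"
      by (rule Henstock_Kurzweil_Integration.integral_cong) (use assms False in auto)
    then show ?thesis using F0 False by simp
  qed
  have D: "(F has_real_derivative f x) (at x)" for x
  proof (cases "x < 0")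
    case True
    have "((\<lambda>_. 0) has_real_derivative f x) (at x)" using True assms by simp
    then show ?thesis
      by (rule has_field_derivative_transform_within_open[where S = "{..<0}"])
         (use True F0 in auto)
  next
    case False
    have "((\<lambda>x. integral {-1..x} f) has_real_derivative f x) (at x within {-1..x+1})"
      by (rule integral_has_real_derivative) (use False assms smooth_continuous_on in auto)
    then have "((\<lambda>x. integral {-1..x} f) has_real_derivative f x) (at x)"
      using False by (simp add: at_within_Icc_at)
    then show ?thesis
      by (rule has_field_derivative_transform_within_open[where S = "{-1<..}"])
         (use False F1 in auto)
  qed
  show thesis using that[of F] D F0 smooth_antideriv[OF assms(1) D] by blast
qed

text \<open>Integrating a normalised bump \<eta> on the unit interval twice gives a smooth step
  \<open>S\<close> and a smooth substitute \<open>R\<close> for the positive part.\<close>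

lemma ramp_exists:
  obtains R S \<eta> :: "real \<Rightarrow> real" where
    "smooth R" "\<And>x. (R has_real_derivative S x) (at x)" "\<And>x. (S has_real_derivative \<eta> x) (at x)"
    "\<And>x. x \<le> 0 \<Longrightarrow> R x = 0" "\<And>x. x \<ge> 1 \<Longrightarrow> R x = R 1 + (x - 1)"
    "\<And>x. 0 \<le> S x" "\<And>x. S x \<le> 1" "\<And>x. x \<le> 0 \<Longrightarrow> S x = 0" "\<And>x. x \<ge> 1 \<Longrightarrow> S x = 1"
    "\<And>x. 0 \<le> \<eta> x" "\<And>x. x \<le> 0 \<Longrightarrow> \<eta> x = 0" "\<And>x. x \<ge> 1 \<Longrightarrow> \<eta> x = 0" "continuous_on UNIV \<eta>"
proof -
  \<comment> \<open>Each factor vanishes on one side, so the product is positive exactly on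
    (0,1).\<close>
  define \<eta>0 where "\<eta>0 x = flat 1 x * (1 * flat 1 ((-1) * x + 1))" for x
  have s0: "smooth \<eta>0" unfolding \<eta>0_def by (rule smooth_mult[OF smooth_flat smooth_affine[OF smooth_flat]])
  have n0: "\<eta>0 x \<ge> 0" for x by (simp add: \<eta>0_def flat_def)
  have z0: "\<eta>0 x = 0" if "x \<le> 0 \<or> x \<ge> 1" for x using that by (auto simp: \<eta>0_def flat_def)
  obtain S0 where S0: "smooth S0" "\<And>x. (S0 has_real_derivative \<eta>0 x) (at x)" "\<And>x. x \<le> 0 \<Longrightarrow> S0 x = 0"
    using smooth_antideriv_exists[OF s0] z0 by metis
  have mono: "S0 x \<le> S0 y" if "x \<le> y" for x y
    using DERIV_nonneg_imp_nondecreasing[OF that, of S0] S0(2) n0 by blast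
  have D01: "\<exists>y. (S0 has_real_derivative y) (at t) \<and> y = 0" if "1 \<le> t" for t
    using S0(2)[of t] z0[of t] that by auto
  have const: "S0 x = S0 1" if "x \<ge> 1" for x
  proof (rule antisym)
    show "S0 x \<le> S0 1"
      by (rule DERIV_nonpos_imp_nonincreasing[OF that]) (use D01 in auto)
  qed (rule mono[OF that])
  \<comment> \<open>Otherwise the monotone \<open>S0\<close> would vanish on [0,1], against its
    positive derivative at 1/2. This permits the normalisation by \<open>S0 1\<close>.\<close>
  have pos: "S0 1 > 0"
  proof (rule ccontr)
    assume "\<not> S0 1 > 0"
    then have S00: "S0 x = 0" if "0 \<le> x" "x \<le> 1" for x
      using mono[of 0 x] mono[of x 1] S0(3)[of 0] that by simp
    have "((\<lambda>_. 0) has_real_derivative 0) (at (1/2))" by (rule DERIV_const)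
    then have "(S0 has_real_derivative 0) (at (1/2))"
      by (rule has_field_derivative_transform_within_open[where S = "{0<..<1}"])
         (use S00 in auto)
    from DERIV_unique[OF S0(2) this] have "\<eta>0 (1/2) = 0" .
    then show False by (simp add: \<eta>0_def flat_def)
  qed
  define \<eta> where "\<eta> x = (1 / S0 1) * \<eta>0 (1 * x + 0)" for x
  define S where "S x = (1 / S0 1) * S0 (1 * x + 0)" for x
  have sS: "smooth S" unfolding S_def by (rule smooth_affine[OF S0(1)])
  have s\<eta>: "smooth \<eta>" unfolding \<eta>_def by (rule smooth_affine[OF s0])
  have S\<eta>: "(S has_real_derivative \<eta> x) (at x)" for x
    using DERIV_cmult[OF S0(2), of "1 / S0 1" x] by (simp add: S_def[abs_def] \<eta>_def)
  have S_0: "S x = 0" if "x \<le> 0" for x using S0(3) that by (simp add: S_def)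
  have S_1: "S x = 1" if "x \<ge> 1" for x using const[OF that] pos by (simp add: S_def)
  obtain R where R: "smooth R" "\<And>x. (R has_real_derivative S x) (at x)" "\<And>x. x \<le> 0 \<Longrightarrow> R x = 0"
    using smooth_antideriv_exists[OF sS S_0] by blast
  have R1: "R x = R 1 + (x - 1)" if "x \<ge> 1" for x
  proof -
    have D: "((\<lambda>x. R x - x) has_real_derivative S x - 1) (at x)" for x
      by (intro derivative_intros R)
    have D01: "\<exists>y. ((\<lambda>x. R x - x) has_real_derivative y) (at t) \<and> y = 0" if "1 \<le> t" for t
      using D[of t] S_1[OF that] by auto
    have "R x - x \<le> R 1 - 1"
      by (rule DERIV_nonpos_imp_nonincreasing[OF that]) (use D01 in auto)
    moreover have "R x - x \<ge> R 1 - 1"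
      by (rule DERIV_nonneg_imp_nondecreasing[OF that]) (use D01 in auto)
    ultimately show ?thesis by simp
  qed
  have "0 \<le> S x \<and> S x \<le> 1" for x
  proof (cases "0 \<le> x")
    case True
    then have "S0 0 \<le> S0 x" by (rule mono)
    moreover have "S0 x \<le> S0 1" using mono[of x 1] const[of x] by (cases "x \<le> 1") auto
    ultimately show ?thesis using S0(3)[of 0] pos by (simp add: S_def)
  next
    case False
    then show ?thesis using S_0[of x] by simp
  qed
  then have Sb: "0 \<le> S x" "S x \<le> 1" for x by auto
  show thesis
  proof (rule that[of R S \<eta>])
    show "0 \<le> \<eta> x" "x \<le> 0 \<Longrightarrow> \<eta> x = 0" "x \<ge> 1 \<Longrightarrow> \<eta> x = 0" for x
      using n0 z0 pos by (simp_all add: \<eta>_def)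
    show "continuous_on UNIV \<eta>" by (rule smooth_continuous_on[OF s\<eta>])
  qed (rule R R1 S\<eta> S_0 S_1 Sb, assumption?)+
qed

section \<open>Testing weak derivatives with ramps and tents\<close>

lemma test_funI:
  assumes "smooth \<phi>" "\<And>x. x \<notin> {p<..<q} \<Longrightarrow> \<phi> x = 0" "{p..q} \<subseteq> U"
  shows "test_fun U \<phi>"
proof -
  have "{x. \<phi> x \<noteq> 0} \<subseteq> {p<..<q}" using assms(2) by blast
  then have "{x. \<phi> x \<noteq> 0} \<subseteq> {p..q}" by fastforce
  then have c: "closure {x. \<phi> x \<noteq> 0} \<subseteq> {p..q}" by (simp add: closure_minimal)
  then have "compact (closure {x. \<phi> x \<noteq> 0})"
    by (metis bounded_closed_interval bounded_subset closed_closure compact_eq_bounded_closed)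
  with assms c show ?thesis unfolding test_fun_def smooth_def by blast
qed

text \<open>A nonzero derivative at \<open>x\<close> would force values different from
  \<open>\<phi> x\<close> at nearby points on both sides, but for \<open>x\<close> outside the open
  interval at least one side consists of zeros. The end points \<open>p\<close> and \<open>q\<close>
  are included.\<close>

lemma deriv_zero_outside:
  fixes \<phi> :: "real \<Rightarrow> real"
  assumes "smooth \<phi>" "\<And>x. x \<notin> {p<..<q} \<Longrightarrow> \<phi> x = 0" "x \<notin> {p<..<q}"
  shows "deriv \<phi> x = 0"
proof (rule ccontr)
  assume "deriv \<phi> x \<noteq> 0"
  then consider "deriv \<phi> x > 0" | "deriv \<phi> x < 0" by linarith
  then obtain \<delta> where \<delta>: "\<delta> > 0" "\<And>h. 0 < h \<Longrightarrow> h < \<delta> \<Longrightarrow> \<phi> (x + h) \<noteq> \<phi> x"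
      "\<And>h. 0 < h \<Longrightarrow> h < \<delta> \<Longrightarrow> \<phi> (x - h) \<noteq> \<phi> x"
  proof cases
    case 1
    obtain d1 d2 where "0 < d1" "\<forall>h>0. h < d1 \<longrightarrow> \<phi> x < \<phi> (x + h)" "0 < d2" "\<forall>h>0. h < d2 \<longrightarrow> \<phi> (x - h) < \<phi> x"
      using DERIV_pos_inc_right[OF smooth_has_deriv[OF assms(1)] 1]
        DERIV_pos_inc_left[OF smooth_has_deriv[OF assms(1)] 1] by blast
    then show thesis by (intro that[of "min d1 d2"]) force+
  next
    case 2
    obtain d1 d2 where "0 < d1" "\<forall>h>0. h < d1 \<longrightarrow> \<phi> x > \<phi> (x + h)" "0 < d2" "\<forall>h>0. h < d2 \<longrightarrow> \<phi> (x - h) > \<phi> x"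
      using DERIV_neg_dec_right[OF smooth_has_deriv[OF assms(1)] 2]
        DERIV_neg_dec_left[OF smooth_has_deriv[OF assms(1)] 2] by blast
    then show thesis by (intro that[of "min d1 d2"]) force+
  qed
  then have "\<phi> (x + \<delta> / 2) \<noteq> \<phi> x" "\<phi> (x - \<delta> / 2) \<noteq> \<phi> x" by auto
  then show False
    using assms(2)[of x] assms(2)[of "x + \<delta> / 2"] assms(2)[of "x - \<delta> / 2"] assms(3) \<delta>(1)
    by (cases "x \<le> p") auto
qed

lemma set_integral_support:
  fixes f \<phi> :: "real \<Rightarrow> real"
  assumes "\<And>x. x \<notin> A \<Longrightarrow> \<phi> x = 0" "A \<subseteq> B"
  shows "(LINT x:B|lborel. f x * \<phi> x) = (LINT x:A|lborel. f x * \<phi> x)"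
  unfolding set_lebesgue_integral_def
  by (rule Bochner_Integration.integral_cong) (use assms in \<open>auto split: split_indicator\<close>)

text \<open>This replaces the open set \<open>U\<close>, which may have many components, by a
  compact interval around the support, where \<open>f\<close> and \<open>g\<close> are
  integrable.\<close>

lemma weak_derivD:
  assumes "weak_deriv U f g" "{p..q} \<subseteq> U" "smooth \<phi>"
    "\<And>x. x \<notin> {p<..<q} \<Longrightarrow> \<phi> x = 0"
  shows "(LINT x:{p..q}|lborel. f x * deriv \<phi> x) = - (LINT x:{p..q}|lborel. g x * \<phi> x)"
proof -
  have "(LINT x:U|lborel. f x * deriv \<phi> x) = - (LINT x:U|lborel. g x * \<phi> x)"
    using assms(1) test_funI[OF assms(3,4,2)] unfolding weak_deriv_def by blast
  moreover have "(LINT x:U|lborel. f x * deriv \<phi> x) = (LINT x:{p..q}|lborel. f x * deriv \<phi> x)"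
    by (rule set_integral_support) (use assms deriv_zero_outside[OF assms(3,4)] in auto)
  moreover have "(LINT x:U|lborel. g x * \<phi> x) = (LINT x:{p..q}|lborel. g x * \<phi> x)"
    by (rule set_integral_support) (use assms in auto)
  ultimately show ?thesis by simp
qed

lemma weak_deriv_integrable:
  assumes "weak_deriv U f g" "{p..q} \<subseteq> U"
  shows "set_integrable lborel {p..q} f" "set_integrable lborel {p..q} g"
  using assms unfolding weak_deriv_def locally_integrable_def by auto

section \<open>Approximating the positive part, the unit step and the point mass\<close>

lemma tendsto_set_integral_mult:
  fixes f \<phi> :: "real \<Rightarrow> real"
  assumes f: "set_integrable lborel A f"
    and m [measurable]: "\<And>k. \<phi>s k \<in> borel_measurable borel" "\<phi> \<in> borel_measurable borel"
    and b: "\<And>k x. x \<in> A \<Longrightarrow> \<bar>\<phi>s k x\<bar> \<le> B"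
    and lim: "\<And>x. x \<in> A \<Longrightarrow> (\<lambda>k. \<phi>s k x) \<longlonglongrightarrow> \<phi> x"
  shows "(\<lambda>k. LINT x:A|lborel. f x * \<phi>s k x) \<longlonglongrightarrow> (LINT x:A|lborel. f x * \<phi> x)"
proof -
  have i [measurable]: "integrable lborel (\<lambda>x. indicator A x * f x)"
    using f by (simp add: set_integrable_def)
  have "(\<lambda>k. LINT x|lborel. (indicator A x * f x) * \<phi>s k x) \<longlonglongrightarrow> (LINT x|lborel. (indicator A x * f x) * \<phi> x)"
  proof (rule integral_dominated_convergence[where w = "\<lambda>x. \<bar>indicator A x * f x\<bar> * B"])
    show "integrable lborel (\<lambda>x. \<bar>indicator A x * f x\<bar> * B)" using i by (intro integrable_mult_left integrable_abs)
    show "AE x in lborel. (\<lambda>k. indicator A x * f x * \<phi>s k x) \<longlonglongrightarrow> indicator A x * f x * \<phi> x"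
      using lim by (intro AE_I2) (auto split: split_indicator intro!: tendsto_mult_left)
    show "AE x in lborel. norm (indicator A x * f x * \<phi>s k x) \<le> \<bar>indicator A x * f x\<bar> * B" for k
      using b by (intro AE_I2) (auto split: split_indicator simp: abs_mult intro!: mult_left_mono)
  qed measurable
  then show ?thesis by (simp add: set_lebesgue_integral_def mult.assoc)
qed

lemma set_integrable_mult_continuous:
  fixes f \<phi> :: "real \<Rightarrow> real"
  assumes f: "set_integrable lborel {p..q} f" and \<phi>: "continuous_on UNIV \<phi>"
  shows "set_integrable lborel {p..q} (\<lambda>x. f x * \<phi> x)"
proof -
  have m [measurable]: "\<phi> \<in> borel_measurable borel" by (rule borel_measurable_continuous_onI[OF \<phi>])
  have i [measurable]: "integrable lborel (\<lambda>x. indicator {p..q} x * f x)"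
    using f by (simp add: set_integrable_def)
  have "bounded (\<phi> ` {p..q})"
    by (intro compact_imp_bounded compact_continuous_image continuous_on_subset[OF \<phi>]) auto
  then obtain B where B: "\<And>x. x \<in> {p..q} \<Longrightarrow> \<bar>\<phi> x\<bar> \<le> B" unfolding bounded_iff by fastforce
  have "integrable lborel (\<lambda>x. (indicator {p..q} x * f x) * \<phi> x)"
  proof (rule Bochner_Integration.integrable_bound)
    show "integrable lborel (\<lambda>x. \<bar>indicator {p..q} x * f x\<bar> * B)" using i by (intro integrable_mult_left integrable_abs)
    show "AE x in lborel. norm (indicator {p..q} x * f x * \<phi> x) \<le> norm (\<bar>indicator {p..q} x * f x\<bar> * B)"
    proof (intro AE_I2)
      fix x show "norm (indicator {p..q} x * f x * \<phi> x) \<le> norm (\<bar>indicator {p..q} x * f x\<bar> * B)"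
        using B[of x] by (auto split: split_indicator simp: abs_mult intro!: mult_left_mono)
    qed
  qed measurable
  then show ?thesis by (simp add: set_integrable_def mult.assoc)
qed

text \<open>Rescaling the ramp by \<open>Suc k / \<kappa>\<close> confines the transition to an
  interval of length \<open>\<kappa> / Suc k\<close> right of 0. The three sequences approximate the
  positive part, its unit step and a point mass at 0; \<open>c k\<close> is the height lost in the
  transition. The parameter \<kappa> lets shifted copies fit into a prescribed interval.\<close>

lemma ramp_seq:
  fixes \<kappa> :: real
  assumes "\<kappa> > 0"
  obtains \<rho> \<sigma> \<eta> :: "nat \<Rightarrow> real \<Rightarrow> real" and c :: "nat \<Rightarrow> real" where
    "\<And>k. smooth (\<rho> k)" "\<And>k. smooth (\<sigma> k)"
    "\<And>k x. (\<rho> k has_real_derivative \<sigma> k x) (at x)" "\<And>k x. (\<sigma> k has_real_derivative \<eta> k x) (at x)"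
    "\<And>k x. x \<le> 0 \<Longrightarrow> \<rho> k x = 0" "\<And>k x. x \<ge> \<kappa> / Suc k \<Longrightarrow> \<rho> k x = x - c k"
    "\<And>k x. 0 \<le> \<rho> k x" "\<And>k x. \<rho> k x \<le> max 0 x" "\<And>x. (\<lambda>k. \<rho> k x) \<longlonglongrightarrow> max 0 x"
    "\<And>k x. 0 \<le> \<sigma> k x" "\<And>k x. \<sigma> k x \<le> 1"
    "\<And>k x. x \<le> 0 \<Longrightarrow> \<sigma> k x = 0" "\<And>k x. x \<ge> \<kappa> / Suc k \<Longrightarrow> \<sigma> k x = 1"
    "\<And>x. (\<lambda>k. \<sigma> k x) \<longlonglongrightarrow> indicator {0<..} x"
    "\<And>k x. 0 \<le> \<eta> k x" "\<And>k x. x \<le> 0 \<Longrightarrow> \<eta> k x = 0" "\<And>k x. x \<ge> \<kappa> / Suc k \<Longrightarrow> \<eta> k x = 0"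
    "\<And>k. continuous_on UNIV (\<eta> k)"
proof -
  obtain R S \<eta>1 :: "real \<Rightarrow> real" where
    R: "smooth R" "\<And>x. (R has_real_derivative S x) (at x)" "\<And>x. (S has_real_derivative \<eta>1 x) (at x)"
    "\<And>x. x \<le> 0 \<Longrightarrow> R x = 0" "\<And>x. x \<ge> 1 \<Longrightarrow> R x = R 1 + (x - 1)"
    and S: "\<And>x. 0 \<le> S x" "\<And>x. S x \<le> 1" "\<And>x. x \<le> 0 \<Longrightarrow> S x = 0" "\<And>x. x \<ge> 1 \<Longrightarrow> S x = 1"
    and \<eta>1: "\<And>x. 0 \<le> \<eta>1 x" "\<And>x. x \<le> 0 \<Longrightarrow> \<eta>1 x = 0" "\<And>x. x \<ge> 1 \<Longrightarrow> \<eta>1 x = 0" "continuous_on UNIV \<eta>1"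
    by (rule ramp_exists) blast
  define m where "m k = real (Suc k) / \<kappa>" for k
  have m: "m k > 0" for k using assms by (simp add: m_def)
  have mc: "x \<ge> \<kappa> / Suc k \<longleftrightarrow> m k * x \<ge> 1" for k x
    using assms by (simp add: m_def field_simps)
  define \<rho> where "\<rho> k x = (1 / m k) * R (m k * x + 0)" for k x
  define \<sigma> where "\<sigma> k x = S (m k * x)" for k x
  define \<eta> where "\<eta> k x = m k * \<eta>1 (m k * x)" for k x
  define c where "c k = (1 - R 1) / m k" for k
  have \<rho>': "(\<rho> k has_real_derivative \<sigma> k x) (at x)" for k x
    unfolding \<rho>_def[abs_def] \<sigma>_def using m[of k]
    by (auto intro!: derivative_eq_intros DERIV_chain2[OF R(2)])
  have \<sigma>': "(\<sigma> k has_real_derivative \<eta> k x) (at x)" for k x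
    unfolding \<eta>_def \<sigma>_def[abs_def]
    using DERIV_chain2[OF R(3) DERIV_cmult_Id[of "m k"]] by (simp add: mult.commute)
  have s\<rho>: "smooth (\<rho> k)" for k unfolding \<rho>_def[abs_def] by (rule smooth_affine[OF R(1)])
  have "\<sigma> k = deriv (\<rho> k)" for k using DERIV_imp_deriv[OF \<rho>'] by (intro ext) simp
  then have s\<sigma>: "smooth (\<sigma> k)" for k using smooth_deriv[OF s\<rho>] by simp
  have \<rho>0: "\<rho> k x = 0" if "x \<le> 0" for k x
    using that m[of k] R(4)[of "m k * x"] by (simp add: \<rho>_def mult_nonneg_nonpos)
  have \<rho>1: "\<rho> k x = x - c k" if "x \<ge> \<kappa> / Suc k" for k x
    using that m[of k] R(5)[of "m k * x"] unfolding mc by (simp add: \<rho>_def c_def field_simps)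
  have \<sigma>0: "\<sigma> k x = 0" if "x \<le> 0" for k x
    using that m[of k] S(3)[of "m k * x"] by (simp add: \<sigma>_def mult_nonneg_nonpos)
  have \<sigma>1: "\<sigma> k x = 1" if "x \<ge> \<kappa> / Suc k" for k x
    using that S(4)[of "m k * x"] unfolding mc by (simp add: \<sigma>_def)
  have \<eta>0: "\<eta> k x = 0" if "x \<le> 0" for k x
    using that m[of k] \<eta>1(2)[of "m k * x"] by (simp add: \<eta>_def mult_nonneg_nonpos)
  have \<eta>1': "\<eta> k x = 0" if "x \<ge> \<kappa> / Suc k" for k x
    using that \<eta>1(3)[of "m k * x"] unfolding mc by (simp add: \<eta>_def)
  have R_nonneg: "R x \<ge> 0" for x
  proof (cases "x \<le> 0")
    case False
    have "R 0 \<le> R x"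
      by (rule DERIV_nonneg_imp_nondecreasing) (use False R(2) S(1) in auto)
    then show ?thesis using R(4)[of 0] by simp
  qed (use R(4) in simp)
  have R_le: "R x \<le> max 0 x" for x
  proof (cases "x \<le> 0")
    case False
    have "R x - x \<le> R 0 - 0"
    proof (rule DERIV_nonpos_imp_nonincreasing[of 0 x "\<lambda>x. R x - x"])
      show "\<exists>y. ((\<lambda>x. R x - x) has_real_derivative y) (at t) \<and> y \<le> 0" for t
        by (intro exI[of _ "S t - 1"] conjI derivative_intros R) (use S in simp)
    qed (use False in simp)
    then show ?thesis using R(4)[of 0] False by simp
  qed (use R(4) in simp)
  have ev: "\<forall>\<^sub>F k in sequentially. x \<ge> \<kappa> / Suc k" if "x > 0" for x
  proof -
    have "(\<lambda>k. \<kappa> / Suc k) \<longlonglongrightarrow> 0" by (rule LIMSEQ_Suc[OF lim_const_over_n])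
    from order_tendstoD(2)[OF this that] show ?thesis by (rule eventually_mono) simp
  qed
  have c_lim: "c \<longlonglongrightarrow> 0"
  proof -
    have "(\<lambda>k. ((1 - R 1) * \<kappa>) / Suc k) \<longlonglongrightarrow> 0" by (rule LIMSEQ_Suc[OF lim_const_over_n])
    then show ?thesis by (simp add: c_def[abs_def] m_def)
  qed
  have lim\<rho>: "(\<lambda>k. \<rho> k x) \<longlonglongrightarrow> max 0 x" for x
  proof (cases "x \<le> 0")
    case False
    have "(\<lambda>k. x - c k) \<longlonglongrightarrow> x - 0" by (intro tendsto_intros c_lim)
    moreover have "\<forall>\<^sub>F k in sequentially. x - c k = \<rho> k x"
      using ev[of x] False by (auto elim!: eventually_mono simp: \<rho>1)
    ultimately show ?thesis using False by (simp add: Lim_transform_eventually)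
  qed (simp add: \<rho>0)
  have lim\<sigma>: "(\<lambda>k. \<sigma> k x) \<longlonglongrightarrow> indicator {0<..} x" for x
  proof (cases "x \<le> 0")
    case False
    then have "\<forall>\<^sub>F k in sequentially. \<sigma> k x = 1"
      using ev[of x] by (auto elim!: eventually_mono simp: \<sigma>1)
    then show ?thesis using False by (simp add: tendsto_eventually)
  qed (simp add: \<sigma>0)
  have \<rho>_nonneg: "0 \<le> \<rho> k x" for k x using R_nonneg[of "m k * x"] m[of k] by (simp add: \<rho>_def)
  have \<rho>_le: "\<rho> k x \<le> max 0 x" for k x
  proof -
    have "R (m k * x) / m k \<le> max 0 (m k * x) / m k"
      using R_le[of "m k * x"] m[of k] by (simp add: divide_right_mono)
    also have "\<dots> = max 0 x" using m[of k] by (auto simp: max_def field_simps zero_le_mult_iff)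
    finally show ?thesis by (simp add: \<rho>_def)
  qed
  have c\<eta>: "continuous_on UNIV (\<eta> k)" for k
    unfolding \<eta>_def[abs_def]
    by (intro continuous_intros continuous_on_compose2[OF \<eta>1(4)]) auto
  have \<sigma>b: "0 \<le> \<sigma> k x" "\<sigma> k x \<le> 1" for k x using S by (auto simp: \<sigma>_def)
  have \<eta>n: "0 \<le> \<eta> k x" for k x using \<eta>1(1) m[of k] by (simp add: \<eta>_def)
  show thesis
    by (rule that[of \<rho> \<sigma> \<eta> c])
       (rule s\<rho> s\<sigma> \<rho>' \<sigma>' \<rho>0 \<rho>1 \<rho>_nonneg \<rho>_le lim\<rho> \<sigma>b \<sigma>0 \<sigma>1 lim\<sigma> \<eta>n \<eta>0 \<eta>1' c\<eta>; assumption)+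
qed


lemma bump_eval:
  fixes f :: "real \<Rightarrow> real" and \<sigma> \<eta> :: "nat \<Rightarrow> real \<Rightarrow> real"
  assumes f: "continuous_on {p..q} f" and y: "p \<le> y" "y < q" and \<kappa>: "\<kappa> > 0"
    and \<sigma>: "\<And>k x. (\<sigma> k has_real_derivative \<eta> k x) (at x)"
      "\<And>k x. x \<le> 0 \<Longrightarrow> \<sigma> k x = 0" "\<And>k x. x \<ge> \<kappa> / Suc k \<Longrightarrow> \<sigma> k x = (1::real)"
    and \<eta>: "\<And>k x. 0 \<le> \<eta> k x" "\<And>k x. x \<le> 0 \<Longrightarrow> \<eta> k x = 0" "\<And>k x. x \<ge> \<kappa> / Suc k \<Longrightarrow> \<eta> k x = 0"
      "\<And>k. continuous_on UNIV (\<eta> k)"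
  shows "(\<lambda>k. LINT x:{p..q}|lborel. f x * \<eta> k (x - y)) \<longlonglongrightarrow> f y"
proof (rule LIMSEQ_I)
  fix e :: real assume "e > 0"
  have "continuous (at y within {p..q}) f"
    using f y by (simp add: continuous_on_eq_continuous_within)
  then obtain \<delta> where \<delta>: "\<delta> > 0" "\<And>x. x \<in> {p..q} \<Longrightarrow> \<bar>x - y\<bar> < \<delta> \<Longrightarrow> \<bar>f x - f y\<bar> < e / 2"
    using \<open>e > 0\<close> unfolding continuous_within_eps_delta dist_real_def by (metis half_gt_zero)
  have c\<eta>': "continuous_on A (\<lambda>x. \<eta> k (x - y))" for k A
    by (intro continuous_on_compose2[OF \<eta>(4)] continuous_intros) auto
  then have c\<eta>: "continuous_on {p..q} (\<lambda>x. \<eta> k (x - y))" "isCont (\<lambda>x. \<eta> k (x - y)) x" for k x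
    using continuous_on_eq_continuous_at[OF open_UNIV] by blast+
  have "(\<lambda>k. \<kappa> / Suc k) \<longlonglongrightarrow> 0" by (rule LIMSEQ_Suc[OF lim_const_over_n])
  then have "\<forall>\<^sub>F k in sequentially. \<kappa> / Suc k < min \<delta> (q - y)"
    using \<delta>(1) y by (intro order_tendstoD(2)) auto
  then obtain N where N: "\<And>k. k \<ge> N \<Longrightarrow> \<kappa> / Suc k < min \<delta> (q - y)"
    by (auto simp: eventually_sequentially)
  have "norm ((LINT x:{p..q}|lborel. f x * \<eta> k (x - y)) - f y) < e" if "k \<ge> N" for k
  proof -
    have one: "(LINT x:{p..q}|lborel. \<eta> k (x - y)) = 1"
    proof -
      have "(LBINT x. \<eta> k (x - y) * indicator {p..q} x) = \<sigma> k (q - y) - \<sigma> k (p - y)"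
      proof (rule integral_FTC_Icc_real)
        have shift: "((\<lambda>x. x - y) has_real_derivative 1) (at x)" for x
          by (auto intro!: derivative_eq_intros)
        show "\<And>x. p \<le> x \<Longrightarrow> x \<le> q \<Longrightarrow> ((\<lambda>x. \<sigma> k (x - y)) has_real_derivative \<eta> k (x - y)) (at x)"
          using DERIV_chain2[OF \<sigma>(1) shift] by simp
      qed (use y c\<eta> in auto)
      then show ?thesis
        using N[OF that] \<sigma>(2)[of "p - y" k] \<sigma>(3)[of k "q - y"] y
        by (simp add: set_lebesgue_integral_def mult.commute)
    qed
    have i1: "set_integrable lborel {p..q} (\<lambda>x. f x * \<eta> k (x - y))"
      and i2: "set_integrable lborel {p..q} (\<lambda>x. \<eta> k (x - y))"
      by (intro borel_integrable_atLeastAtMost' continuous_intros f c\<eta>)+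
    have "(LINT x:{p..q}|lborel. f x * \<eta> k (x - y)) - f y =
        (LINT x:{p..q}|lborel. f x * \<eta> k (x - y)) - (LINT x:{p..q}|lborel. f y * \<eta> k (x - y))"
      using one by simp
    also have "\<dots> = (LINT x:{p..q}|lborel. (f x - f y) * \<eta> k (x - y))"
      using i1 i2 by (subst set_integral_diff(2)[symmetric]) (auto simp: algebra_simps)
    finally have "norm ((LINT x:{p..q}|lborel. f x * \<eta> k (x - y)) - f y) =
        norm (LINT x:{p..q}|lborel. (f x - f y) * \<eta> k (x - y))" by simp
    also have "\<dots> \<le> (LINT x:{p..q}|lborel. norm ((f x - f y) * \<eta> k (x - y)))"
      unfolding set_lebesgue_integral_def
      by (rule order_trans[OF integral_norm_bound]) (auto intro!: Bochner_Integration.integral_mono' simp: abs_mult)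
    also have "\<dots> \<le> (LINT x:{p..q}|lborel. (e / 2) * \<eta> k (x - y))"
    proof (rule set_integral_mono)
      show "set_integrable lborel {p..q} (\<lambda>x. norm ((f x - f y) * \<eta> k (x - y)))"
        by (intro borel_integrable_atLeastAtMost' continuous_intros f c\<eta>)
      show "set_integrable lborel {p..q} (\<lambda>x. (e / 2) * \<eta> k (x - y))" using i2 by auto
      fix x assume x: "x \<in> {p..q}"
      show "norm ((f x - f y) * \<eta> k (x - y)) \<le> (e / 2) * \<eta> k (x - y)"
      proof (cases "0 < x - y \<and> x - y < \<kappa> / Suc k")
        case True
        then have "\<bar>f x - f y\<bar> \<le> e / 2" using \<delta>(2)[OF x] N[OF that] by force
        from mult_right_mono[OF this \<eta>(1)[of k "x - y"]] show ?thesis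
            using \<eta>(1)[of k "x - y"] by (simp add: abs_mult)
      next
        case False
        then have "\<eta> k (x - y) = 0" using \<eta>(2,3) by (meson not_le)
        then show ?thesis by simp
      qed
    qed
    also have "\<dots> = e / 2" using one by simp
    finally show ?thesis using \<open>e > 0\<close> by simp
  qed
  then show "\<exists>no. \<forall>n\<ge>no. norm ((LINT x:{p..q}|lborel. f x * \<eta> n (x - y)) - f y) < e" by blast
qed

section \<open>Weak derivatives agree with continuous classical ones\<close>

lemma AE_zero_if_interval_integrals_zero:
  fixes f :: "real \<Rightarrow> real"
  assumes f: "set_integrable lborel {p..q} f" and "p \<le> q"
    and z: "\<And>y. y \<in> {p..q} \<Longrightarrow> (LINT x:{p<..y}|lborel. f x) = 0"
  shows "AE x in lborel. x \<in> {p..q} \<longrightarrow> f x = 0"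
proof -
  define F where "F x = indicator {p<..q} x * f x" for x
  have "set_integrable lborel {p<..q} f" by (rule set_integrable_subset[OF f]) auto
  then have F: "integrable lborel F" by (simp add: F_def[abs_def] set_integrable_def)
  have tot: "(LINT x|lborel. F x) = 0"
    using z[of q] assms(2) by (simp add: F_def set_lebesgue_integral_def)
  \<comment> \<open>The sets over which \<open>F\<close> integrates to zero form a Dynkin system:
    complements use that the total integral vanishes, disjoint unions use countable additivity.
    Half-lines are an intersection-stable generator, so every Borel set is reached.\<close>
  have Int_stable_atMost: "Int_stable (range (\<lambda>a::real. {..a}))"
    by (auto simp: Int_stable_def)
  have subset_Pow: "range (\<lambda>a::real. {..a}) \<subseteq> Pow UNIV" by simp
  have "(LINT x:A|lborel. F x) = 0" if "A \<in> sets lborel" for A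
  proof -
    have "A \<in> sigma_sets UNIV (range (\<lambda>a::real. {..a}))"
      using that by (simp add: borel_eq_atMost)
    from Int_stable_atMost subset_Pow this show ?thesis
    proof (induction rule: sigma_sets_induct_disjoint)
      case (basic A)
      then obtain y where A: "A = {..y}" by blast
      show ?case
      proof (cases "y < p")
        case True
        then have "(\<lambda>x. indicator A x *\<^sub>R F x) = (\<lambda>_. 0)" by (auto simp: A F_def fun_eq_iff split: split_indicator)
        then show ?thesis by (simp add: set_lebesgue_integral_def)
      next
        case False
        have "(\<lambda>x. indicator A x *\<^sub>R F x) = (\<lambda>x. indicator {p<..min y q} x *\<^sub>R f x)"
          by (auto simp: A F_def fun_eq_iff split: split_indicator)
        then show ?thesis using z[of "min y q"] False assms(2) by (simp add: set_lebesgue_integral_def)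
      qed
    next
      case empty
      show ?case by (simp add: set_lebesgue_integral_def)
    next
      case (compl A)
      then have A: "A \<in> sets lborel" by (simp add: borel_eq_atMost)
      have "(LINT x:UNIV - A|lborel. F x) = (LINT x|lborel. F x - indicator A x *\<^sub>R F x)"
        unfolding set_lebesgue_integral_def
        by (rule Bochner_Integration.integral_cong) (auto split: split_indicator)
      also have "\<dots> = (LINT x|lborel. F x) - (LINT x:A|lborel. F x)"
        unfolding set_lebesgue_integral_def
        by (rule Bochner_Integration.integral_diff[OF F integrable_mult_indicator[OF A F]])
      finally show ?case using tot compl by simp
    next
      case (union A)
      then have A: "A i \<in> sets lborel" for i by (auto simp: borel_eq_atMost)
      have "(LINT x:(\<Union>i. A i)|lborel. F x) = (\<Sum>i. (LINT x:(A i)|lborel. F x))"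
      proof (rule lebesgue_integral_countable_add)
        show "set_integrable lborel (\<Union>i. A i) F"
          unfolding set_integrable_def by (rule integrable_mult_indicator[OF _ F]) (use A in auto)
      qed (use A union in \<open>auto simp: disjoint_family_on_def\<close>)
      then show ?case using union by simp
    qed
  qed
  then have "AE x in lborel. F x = 0" by (rule sigma_finite_measure.density_zero[OF lborel.sigma_finite_measure_axioms F])
  \<comment> \<open>\<open>F\<close> is cut off to the half-open interval, so the point
    \<open>p\<close> is treated as a null set.\<close>
  moreover have "AE x in lborel. x \<noteq> p" by (rule AE_lborel_singleton)
  ultimately show ?thesis by eventually_elim (auto simp: F_def)
qed


text \<open>This is the du Bois-Reymond argument. Both \<open>g\<close> and \<open>d\<close> satisfy
  integration by parts against \<open>v\<close>, so \<open>g - d\<close> is orthogonal to test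
  functions. Differences of smooth steps approximate the indicators of (p,y], and hence the
  integrals of \<open>g - d\<close> over these intervals vanish.\<close>

lemma weak_deriv_AE_eq:
  fixes v d g :: "real \<Rightarrow> real"
  assumes w: "weak_deriv {a<..<b} v g"
    and v: "\<And>x. x \<in> {a..b} \<Longrightarrow> (v has_real_derivative d x) (at x within {a..b})"
    and d: "continuous_on {a..b} d"
  shows "AE x in lborel. x \<in> {a<..<b} \<longrightarrow> g x = d x"
proof -
  have loc: "AE x in lborel. x \<in> {p..q} \<longrightarrow> g x = d x" if pq: "a < p" "p < q" "q < b" for p q
  proof -
    \<comment> \<open>A smooth step starting at some \<open>y\<close> up to \<open>q\<close> has
      reached 1 by \<open>q + \<kappa>\<close>; this room inside (a,b) makes the difference of two
      steps compactly supported.\<close>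
    define \<kappa> where "\<kappa> = (b - q) / 2"
    have \<kappa>: "\<kappa> > 0" "q + \<kappa> < b" using pq by (auto simp: \<kappa>_def field_simps)
    have sub: "{p..q + \<kappa>} \<subseteq> {a<..<b}" "{p..q + \<kappa>} \<subseteq> {a..b}" using pq \<kappa> by auto
    have ig: "set_integrable lborel {p..q + \<kappa>} g" by (rule weak_deriv_integrable(2)[OF w sub(1)])
    have cd: "continuous_on {p..q + \<kappa>} d" by (rule continuous_on_subset[OF d sub(2)])
    have id: "set_integrable lborel {p..q + \<kappa>} d" by (rule borel_integrable_atLeastAtMost'[OF cd])
    have i: "set_integrable lborel {p..q + \<kappa>} (\<lambda>x. g x - d x)" using ig id by simp
    have v': "(v has_real_derivative d x) (at x within {p..q + \<kappa>})" if "x \<in> {p..q + \<kappa>}" for x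
      using v[of x] sub that by (meson DERIV_subset subsetD)
    have cv: "continuous_on {p..q + \<kappa>} v" using v' by (rule DERIV_continuous_on)
    have zero: "(LINT x:{p..q + \<kappa>}|lborel. (g x - d x) * \<phi> x) = 0"
      if \<phi>: "smooth \<phi>" "\<And>x. x \<notin> {p<..<q + \<kappa>} \<Longrightarrow> \<phi> x = 0" for \<phi>
    proof -
      have c\<phi>: "continuous_on A \<phi>" "continuous_on A (deriv \<phi>)" for A
        using \<phi>(1) smooth_continuous_on smooth_deriv by blast+
      have 1: "(LINT x:{p..q + \<kappa>}|lborel. v x * deriv \<phi> x) = - (LINT x:{p..q + \<kappa>}|lborel. g x * \<phi> x)"
        by (rule weak_derivD[OF w sub(1) \<phi>])
      have 2: "(LBINT x. indicator {p..q + \<kappa>} x *\<^sub>R (v x * deriv \<phi> x + d x * \<phi> x)) = v (q + \<kappa>) * \<phi> (q + \<kappa>) - v p * \<phi> p"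
      proof (rule integral_FTC_atLeastAtMost)
        show "((\<lambda>x. v x * \<phi> x) has_vector_derivative v x * deriv \<phi> x + d x * \<phi> x) (at x within {p..q + \<kappa>})"
          if "p \<le> x" "x \<le> q + \<kappa>" for x
          unfolding has_real_derivative_iff_has_vector_derivative[symmetric]
          using DERIV_mult[OF v'[of x] has_field_derivative_at_within[OF smooth_has_deriv[OF \<phi>(1)]]] that
          by (simp add: algebra_simps)
      qed (use pq \<kappa> in \<open>auto intro!: continuous_intros cv cd c\<phi>\<close>)
      have "(LINT x:{p..q + \<kappa>}|lborel. v x * deriv \<phi> x + d x * \<phi> x) = 0"
        using 2 \<phi>(2)[of p] \<phi>(2)[of "q + \<kappa>"] by (simp add: set_lebesgue_integral_def)
      moreover have "set_integrable lborel {p..q + \<kappa>} (\<lambda>x. v x * deriv \<phi> x)"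
          "set_integrable lborel {p..q + \<kappa>} (\<lambda>x. d x * \<phi> x)"
        by (intro borel_integrable_atLeastAtMost' continuous_intros cv cd c\<phi>)+
      moreover have "set_integrable lborel {p..q + \<kappa>} (\<lambda>x. g x * \<phi> x)"
        by (rule set_integrable_mult_continuous[OF ig c\<phi>(1)])
      ultimately show ?thesis using 1 by (simp add: left_diff_distrib set_integral_add)
    qed
    have int0: "(LINT x:{p<..y}|lborel. g x - d x) = 0" if y: "y \<in> {p..q}" for y
    proof -
      obtain \<rho> \<sigma> \<eta> :: "nat \<Rightarrow> real \<Rightarrow> real" and c where
        R: "\<And>k. smooth (\<sigma> k)" "\<And>k x. 0 \<le> \<sigma> k x" "\<And>k x. \<sigma> k x \<le> 1"
        "\<And>k x. x \<le> 0 \<Longrightarrow> \<sigma> k x = 0" "\<And>k x. x \<ge> \<kappa> / Suc k \<Longrightarrow> \<sigma> k x = 1"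
        "\<And>x. (\<lambda>k. \<sigma> k x) \<longlonglongrightarrow> indicator {0<..} x"
        by (rule ramp_seq[OF \<kappa>(1)]) (rule that; assumption)
      \<comment> \<open>A step at \<open>p\<close> minus a step at \<open>y\<close>, with the
        indicator of (p,y] as its limit. The redundant factors match the form of
        \<open>smooth_affine\<close>.\<close>
      define \<phi> where "\<phi> k x = 1 * \<sigma> k (1 * x + - p) + (-1) * \<sigma> k (1 * x + - y)" for k x
      have s: "smooth (\<phi> k)" for k
        unfolding \<phi>_def[abs_def] by (intro smooth_add smooth_affine[OF R(1)])
      have small: "\<kappa> / Suc k \<le> \<kappa>" for k using \<kappa> by (simp add: field_simps)
      have "\<phi> k x = 0" if x: "x \<notin> {p<..<q + \<kappa>}" for k x
      proof (cases "x \<le> p")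
        case True
        then show ?thesis using y by (simp add: \<phi>_def R(4))
      next
        case False
        then have "x \<ge> q + \<kappa>" using x by simp
        then show ?thesis using small[of k] y by (simp add: \<phi>_def R(5))
      qed
      then have "(LINT x:{p..q + \<kappa>}|lborel. (g x - d x) * \<phi> k x) = 0" for k
        by (rule zero[OF s])
      moreover have "(\<lambda>k. LINT x:{p..q + \<kappa>}|lborel. (g x - d x) * \<phi> k x) \<longlonglongrightarrow>
          (LINT x:{p..q + \<kappa>}|lborel. (g x - d x) * indicator {p<..y} x)"
      proof (rule tendsto_set_integral_mult[OF i, where B = 1])
        show "\<phi> k \<in> borel_measurable borel" for k
          by (rule borel_measurable_continuous_onI[OF smooth_continuous_on[OF s]])
        show "\<bar>\<phi> k x\<bar> \<le> 1" for k x using R(2,3)[of k "x - p"] R(2,3)[of k "x - y"] by (simp add: \<phi>_def)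
        have "(\<lambda>k. \<phi> k x) \<longlonglongrightarrow> 1 * indicator {0<..} (1 * x + - p) + (-1) * indicator {0<..} (1 * x + - y)" for x
          unfolding \<phi>_def by (intro tendsto_intros R(6))
        also have "1 * indicator {0<..} (1 * x + - p) + (-1) * indicator {0<..} (1 * x + - y) = (indicator {p<..y} x :: real)" for x
          using y by (auto split: split_indicator)
        finally show "(\<lambda>k. \<phi> k x) \<longlonglongrightarrow> indicator {p<..y} x" for x .
      qed measurable
      ultimately have "(LINT x:{p..q + \<kappa>}|lborel. (g x - d x) * indicator {p<..y} x) = 0"
        by (simp add: LIMSEQ_const_iff)
      also have "(LINT x:{p..q + \<kappa>}|lborel. (g x - d x) * indicator {p<..y} x) = (LINT x:{p<..y}|lborel. (g x - d x))"
        unfolding set_lebesgue_integral_def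
        by (rule Bochner_Integration.integral_cong) (use y \<kappa> in \<open>auto split: split_indicator\<close>)
      finally show ?thesis .
    qed
    have "AE x in lborel. x \<in> {p..q} \<longrightarrow> g x - d x = 0"
      by (rule AE_zero_if_interval_integrals_zero[OF set_integrable_subset[OF i]]) (use pq \<kappa> int0 in auto)
    then show ?thesis by simp
  qed
  \<comment> \<open>With the summand 3 the margin is at most a third of the length, so
    \<open>p n < q n\<close> already holds for n = 0.\<close>
  define p where "p n = a + (b - a) / (real n + 3)" for n :: nat
  define q where "q n = b - (b - a) / (real n + 3)" for n :: nat
  show ?thesis
  proof (cases "a < b")
    case True
    have "a < p n \<and> p n < q n \<and> q n < b" for n
    proof -
      define \<delta> where "\<delta> = (b - a) / (real n + 3)"
      have "\<delta> \<le> (b - a) / 3" "\<delta> > 0"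
        using True divide_left_mono[of 3 "real n + 3" "b - a"] by (auto simp: \<delta>_def)
      then show ?thesis using True unfolding p_def q_def \<delta>_def[symmetric] by auto
    qed
    then have "AE x in lborel. \<forall>n. x \<in> {p n..q n} \<longrightarrow> g x = d x"
      unfolding AE_all_countable using loc by blast
    then show ?thesis
    proof eventually_elim
      case (elim x)
      show ?case
      proof
        assume x: "x \<in> {a<..<b}"
        define m where "m = min (x - a) (b - x)"
        have "m > 0" using x by (simp add: m_def)
        obtain n :: nat where "(b - a) / m < real n" using reals_Archimedean2 by blast
        then have "(b - a) < m * (real n + 3)" using \<open>m > 0\<close> by (simp add: field_simps)
        then have "(b - a) / (real n + 3) < m" by (simp add: field_simps)
        then have "x \<in> {p n..q n}" by (auto simp: p_def q_def m_def)
        then show "g x = d x" using elim by blast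
      qed
    qed
  qed simp
qed


section \<open>Tents and second differences of the slope\<close>

definition tent :: "real \<Rightarrow> real \<Rightarrow> real \<Rightarrow> real \<Rightarrow> real" where
  "tent \<alpha> \<beta> \<gamma> x = (1 / (\<beta> - \<alpha>)) * max 0 (x - \<alpha>)
     + ((- (1 / (\<beta> - \<alpha>) + 1 / (\<gamma> - \<beta>))) * max 0 (x - \<beta>) + (1 / (\<gamma> - \<beta>)) * max 0 (x - \<gamma>))"

text \<open>The second derivative of the tent consists of point masses at \<alpha>, \<beta> and
  \<gamma>, so moving both derivatives from \<open>w\<close> onto the tent leaves a difference of
  two difference quotients of \<open>d\<close>. The tent is written with positive parts so that
  replacing each of them by \<open>\<rho> k\<close> gives admissible test functions;
  \<open>\<sigma> k\<close> and \<open>\<eta> k\<close> then give their derivatives.\<close>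

lemma second_difference_tent:
  fixes d g h w :: "real \<Rightarrow> real"
  assumes ord: "\<alpha> < \<beta>" "\<beta> < \<gamma>" "\<gamma> < q" and sub: "{\<alpha>..q} \<subseteq> P"
    and wd: "weak_deriv P g h" "weak_deriv P h w"
    and d: "continuous_on {\<alpha>..q} d" "AE x in lborel. x \<in> {\<alpha>..q} \<longrightarrow> g x = d x"
  shows "(LINT x:{\<alpha>..q}|lborel. w x * tent \<alpha> \<beta> \<gamma> x) =
    (d \<gamma> - d \<beta>) / (\<gamma> - \<beta>) - (d \<beta> - d \<alpha>) / (\<beta> - \<alpha>)"
proof -
  define \<kappa> where "\<kappa> = (q - \<gamma>) / 2"
  have \<kappa>: "\<kappa> > 0" "\<gamma> + \<kappa> < q" using ord by (auto simp: \<kappa>_def field_simps)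
  obtain \<rho> \<sigma> \<eta> :: "nat \<Rightarrow> real \<Rightarrow> real" and c where
    R: "\<And>k. smooth (\<rho> k)" "\<And>k. smooth (\<sigma> k)"
    "\<And>k x. (\<rho> k has_real_derivative \<sigma> k x) (at x)" "\<And>k x. (\<sigma> k has_real_derivative \<eta> k x) (at x)"
    "\<And>k x. x \<le> 0 \<Longrightarrow> \<rho> k x = 0" "\<And>k x. x \<ge> \<kappa> / Suc k \<Longrightarrow> \<rho> k x = x - c k"
    "\<And>k x. 0 \<le> \<rho> k x" "\<And>k x. \<rho> k x \<le> max 0 x" "\<And>x. (\<lambda>k. \<rho> k x) \<longlonglongrightarrow> max 0 x"
    and S: "\<And>k x. x \<le> 0 \<Longrightarrow> \<sigma> k x = 0" "\<And>k x. x \<ge> \<kappa> / Suc k \<Longrightarrow> \<sigma> k x = 1"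
    and E: "\<And>k x. 0 \<le> \<eta> k x" "\<And>k x. x \<le> 0 \<Longrightarrow> \<eta> k x = 0" "\<And>k x. x \<ge> \<kappa> / Suc k \<Longrightarrow> \<eta> k x = 0"
    "\<And>k. continuous_on UNIV (\<eta> k)"
    by (rule ramp_seq[OF \<kappa>(1)]) (rule that; assumption)
  define A where "A = 1 / (\<beta> - \<alpha>)"
  define C where "C = 1 / (\<gamma> - \<beta>)"
  have AC: "A > 0" "C > 0" using ord by (auto simp: A_def C_def)
  \<comment> \<open>The coefficients sum to zero, which cancels \<open>x\<close> and the offset
    \<open>c k\<close> beyond the last transition. This first moment cancels the remaining
    constants, so the smoothed tent vanishes there.\<close>
  have moment: "A * \<alpha> - (A + C) * \<beta> + C * \<gamma> = 0"
  proof -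
    have "A * (\<beta> - \<alpha>) = 1" "C * (\<gamma> - \<beta>) = 1" using ord by (auto simp: A_def C_def)
    then show ?thesis by (simp add: algebra_simps)
  qed
  have small: "\<kappa> / Suc k \<le> \<kappa>" for k using \<kappa> by (simp add: field_simps)
  define comb where "comb f x = A * f (1 * x + - \<alpha>) + ((- (A + C)) * f (1 * x + - \<beta>) + C * f (1 * x + - \<gamma>))"
    for f :: "real \<Rightarrow> real" and x
  have s\<rho>: "smooth (comb (\<rho> k))" and s\<sigma>: "smooth (comb (\<sigma> k))" for k
    unfolding comb_def[abs_def] by (intro smooth_add smooth_affine R)+
  have shift: "((\<lambda>x. 1 * x + - y) has_real_derivative 1) (at x)" for x y :: real
    by (auto intro!: derivative_eq_intros)
  have comb_deriv: "(comb f has_real_derivative comb f' x) (at x)"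
    if "\<And>x. (f has_real_derivative f' x) (at x)" for f f' x
  proof -
    have "((\<lambda>x. f (1 * x + - y)) has_real_derivative f' (1 * x + - y)) (at x)" for y
      using DERIV_chain2[OF that shift] by simp
    then show ?thesis unfolding comb_def[abs_def] by (intro DERIV_add DERIV_cmult)
  qed
  have d\<rho>: "deriv (comb (\<rho> k)) = comb (\<sigma> k)" and d\<sigma>: "deriv (comb (\<sigma> k)) = comb (\<eta> k)" for k
    using DERIV_imp_deriv[OF comb_deriv] R(3,4) by blast+
  have out\<rho>: "comb (\<rho> k) x = 0" and out\<sigma>: "comb (\<sigma> k) x = 0" if "x \<notin> {\<alpha><..<q}" for k x
  proof -
    have "comb (\<rho> k) x = 0 \<and> comb (\<sigma> k) x = 0"
    proof (cases "x \<le> \<alpha>")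
      case True
      then show ?thesis using ord by (simp add: comb_def R(5) S(1))
    next
      case False
      with that have x: "x \<ge> q" by simp
      have "x - y \<ge> \<kappa> / Suc k" if "y \<le> \<gamma>" for y
        using x small[of k] \<kappa> that by linarith
      then have "comb (\<rho> k) x = A * (x - \<alpha> - c k) + (- (A + C) * (x - \<beta> - c k) + C * (x - \<gamma> - c k))"
          "comb (\<sigma> k) x = A + (- (A + C) + C)"
        using ord by (simp_all add: comb_def R(6) S(2))
      then show ?thesis using moment by (simp add: algebra_simps)
    qed
    then show "comb (\<rho> k) x = 0" "comb (\<sigma> k) x = 0" by auto
  qed
  have e1: "(LINT x:{\<alpha>..q}|lborel. h x * comb (\<sigma> k) x) = - (LINT x:{\<alpha>..q}|lborel. w x * comb (\<rho> k) x)" for k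
    using weak_derivD[OF wd(2) sub s\<rho> out\<rho>] d\<rho> by simp
  have e2: "(LINT x:{\<alpha>..q}|lborel. g x * comb (\<eta> k) x) = - (LINT x:{\<alpha>..q}|lborel. h x * comb (\<sigma> k) x)" for k
    using weak_derivD[OF wd(1) sub s\<sigma> out\<sigma>] d\<sigma> by simp
  note ig = weak_deriv_integrable(1)[OF wd(1) sub] and iw = weak_deriv_integrable(2)[OF wd(2) sub]
  have cE: "continuous_on UNIV (\<lambda>x. \<eta> k (x - y))" for k y
    by (intro continuous_on_compose2[OF E(4)] continuous_intros) auto
  have c\<eta>: "continuous_on UNIV (comb (\<eta> k))" for k
    unfolding comb_def[abs_def] using cE by (intro continuous_intros) auto
  \<comment> \<open>The concentrating bumps evaluate at points, which is meaningful for the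
    continuous \<open>d\<close> but not for the almost everywhere representative
    \<open>g\<close>.\<close>
  have e3: "(LINT x:{\<alpha>..q}|lborel. g x * comb (\<eta> k) x) = (LINT x:{\<alpha>..q}|lborel. d x * comb (\<eta> k) x)" for k
  proof -
    have "set_integrable lborel {\<alpha>..q} (\<lambda>x. g x * comb (\<eta> k) x)"
        "set_integrable lborel {\<alpha>..q} (\<lambda>x. d x * comb (\<eta> k) x)"
      by (intro set_integrable_mult_continuous ig c\<eta> borel_integrable_atLeastAtMost' d)+
    then show ?thesis unfolding set_lebesgue_integral_def set_integrable_def
      by (intro integral_cong_AE borel_measurable_integrable)
         (use d(2) in \<open>auto elim!: eventually_mono split: split_indicator\<close>)
  qed
  have iE: "set_integrable lborel {\<alpha>..q} (\<lambda>x. d x * \<eta> k (x - y))" for k y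
    by (rule set_integrable_mult_continuous[OF borel_integrable_atLeastAtMost'[OF d(1)] cE])
  have iA: "set_integrable lborel {\<alpha>..q} (\<lambda>x. K * (d x * \<eta> k (x - y)))" for K k y
    using iE by simp
  have "(LINT x:{\<alpha>..q}|lborel. d x * comb (\<eta> k) x) =
      A * (LINT x:{\<alpha>..q}|lborel. d x * \<eta> k (x - \<alpha>))
      + (- (A + C) * (LINT x:{\<alpha>..q}|lborel. d x * \<eta> k (x - \<beta>)) + C * (LINT x:{\<alpha>..q}|lborel. d x * \<eta> k (x - \<gamma>)))" for k
  proof -
    have "(LINT x:{\<alpha>..q}|lborel. d x * comb (\<eta> k) x) = (LINT x:{\<alpha>..q}|lborel.
        A * (d x * \<eta> k (x - \<alpha>)) + (- (A + C) * (d x * \<eta> k (x - \<beta>)) + C * (d x * \<eta> k (x - \<gamma>))))"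
      by (simp add: comb_def algebra_simps)
    also have "\<dots> = (LINT x:{\<alpha>..q}|lborel. A * (d x * \<eta> k (x - \<alpha>))) +
        ((LINT x:{\<alpha>..q}|lborel. - (A + C) * (d x * \<eta> k (x - \<beta>))) + (LINT x:{\<alpha>..q}|lborel. C * (d x * \<eta> k (x - \<gamma>))))"
      unfolding set_integral_add(2)[OF iA set_integral_add(1)[OF iA iA]] set_integral_add(2)[OF iA iA] ..
    finally show ?thesis by simp
  qed
  moreover have ev: "(\<lambda>k. LINT x:{\<alpha>..q}|lborel. d x * \<eta> k (x - y)) \<longlonglongrightarrow> d y" if "\<alpha> \<le> y" "y < q" for y
    by (rule bump_eval[OF d(1) that \<kappa>(1) R(4) S E])
  ultimately have l1: "(\<lambda>k. LINT x:{\<alpha>..q}|lborel. d x * comb (\<eta> k) x) \<longlonglongrightarrow>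
      A * d \<alpha> + (- (A + C) * d \<beta> + C * d \<gamma>)"
    using ord by (simp only:) (intro tendsto_intros ev, auto)
  have tent: "tent \<alpha> \<beta> \<gamma> x = comb (max 0) x" for x by (simp add: tent_def comb_def A_def C_def)
  have l2: "(\<lambda>k. LINT x:{\<alpha>..q}|lborel. w x * comb (\<rho> k) x) \<longlonglongrightarrow> (LINT x:{\<alpha>..q}|lborel. w x * tent \<alpha> \<beta> \<gamma> x)"
  proof (rule tendsto_set_integral_mult[OF iw, where B = "A * (q - \<alpha>) + ((A + C) * (q - \<alpha>) + C * (q - \<alpha>))"])
    show "comb (\<rho> k) \<in> borel_measurable borel" for k
      by (rule borel_measurable_continuous_onI[OF smooth_continuous_on[OF s\<rho>]])
    show "tent \<alpha> \<beta> \<gamma> \<in> borel_measurable borel"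
      unfolding tent_def[abs_def] by measurable
    show "(\<lambda>k. comb (\<rho> k) x) \<longlonglongrightarrow> tent \<alpha> \<beta> \<gamma> x" for x
      unfolding tent comb_def by (intro tendsto_intros R)
    fix k x assume x: "x \<in> {\<alpha>..q}"
    have r: "\<bar>\<rho> k (1 * x + - y)\<bar> \<le> q - \<alpha>" if "\<alpha> \<le> y" for y
      using R(7,8)[of k "x - y"] x that ord by (simp add: max_def split: if_splits)
    have "\<bar>comb (\<rho> k) x\<bar> \<le> \<bar>A * \<rho> k (1 * x + - \<alpha>)\<bar> + (\<bar>(- (A + C)) * \<rho> k (1 * x + - \<beta>)\<bar> + \<bar>C * \<rho> k (1 * x + - \<gamma>)\<bar>)"
      unfolding comb_def by linarith
    also have "\<dots> \<le> A * (q - \<alpha>) + ((A + C) * (q - \<alpha>) + C * (q - \<alpha>))"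
      unfolding abs_mult abs_minus_cancel using AC ord
      by (intro add_mono mult_mono r) auto
    finally show "\<bar>comb (\<rho> k) x\<bar> \<le> A * (q - \<alpha>) + ((A + C) * (q - \<alpha>) + C * (q - \<alpha>))" .
  qed
  have "(\<lambda>k. LINT x:{\<alpha>..q}|lborel. d x * comb (\<eta> k) x) \<longlonglongrightarrow> (LINT x:{\<alpha>..q}|lborel. w x * tent \<alpha> \<beta> \<gamma> x)"
    using l2 e1 e2 e3 by simp
  from LIMSEQ_unique[OF this l1] show ?thesis
    by (simp add: A_def C_def diff_divide_distrib algebra_simps)
qed

lemma tent_simps:
  assumes "\<alpha> < \<beta>" "\<beta> < \<gamma>"
  shows "\<alpha> \<le> x \<Longrightarrow> x \<le> \<beta> \<Longrightarrow> tent \<alpha> \<beta> \<gamma> x = (x - \<alpha>) / (\<beta> - \<alpha>)"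
    and "\<beta> \<le> x \<Longrightarrow> x \<le> \<gamma> \<Longrightarrow> tent \<alpha> \<beta> \<gamma> x = (\<gamma> - x) / (\<gamma> - \<beta>)"
    and "\<gamma> \<le> x \<Longrightarrow> tent \<alpha> \<beta> \<gamma> x = 0"
proof -
  define A where "A = 1 / (\<beta> - \<alpha>)"
  define C where "C = 1 / (\<gamma> - \<beta>)"
  have m: "A * (\<beta> - \<alpha>) = 1" "C * (\<gamma> - \<beta>) = 1" using assms by (auto simp: A_def C_def)
  have t: "tent \<alpha> \<beta> \<gamma> x = A * max 0 (x - \<alpha>) + (- (A + C) * max 0 (x - \<beta>) + C * max 0 (x - \<gamma>))"
    by (simp add: tent_def A_def C_def)
  show "\<alpha> \<le> x \<Longrightarrow> x \<le> \<beta> \<Longrightarrow> tent \<alpha> \<beta> \<gamma> x = (x - \<alpha>) / (\<beta> - \<alpha>)"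
    using assms by (simp add: tent_def)
  show "\<gamma> \<le> x \<Longrightarrow> tent \<alpha> \<beta> \<gamma> x = 0"
    using assms m by (simp add: t algebra_simps)
  assume x: "\<beta> \<le> x" "x \<le> \<gamma>"
  have "(\<gamma> - x) / (\<gamma> - \<beta>) = C * (\<gamma> - x)" by (simp add: C_def)
  then show "tent \<alpha> \<beta> \<gamma> x = (\<gamma> - x) / (\<gamma> - \<beta>)"
    using assms x m by (simp add: t algebra_simps)
qed

text \<open>Narrowing the right flank of the tent at the maximum point \<open>\<beta>\<close> of \<open>d\<close> replaces the condition
  \<open>d' \<beta> = 0\<close>, which would need more regularity.\<close>

lemma rise_to_max_le:
  fixes d g h w :: "real \<Rightarrow> real"
  assumes ord: "\<alpha> < \<beta>" "\<beta> < q" and sub: "{\<alpha>..q} \<subseteq> P"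
    and wd: "weak_deriv P g h" "weak_deriv P h w"
    and d: "continuous_on {\<alpha>..q} d" "AE x in lborel. x \<in> {\<alpha>..q} \<longrightarrow> g x = d x"
    and max: "\<And>x. x \<in> {\<beta>..q} \<Longrightarrow> d x \<le> d \<beta>"
  shows "d \<beta> - d \<alpha> \<le> (LINT x:{\<alpha>..\<beta>}|lborel. (x - \<alpha>) * \<bar>w x\<bar>)"
proof -
  define \<gamma> where "\<gamma> n = \<beta> + ((q - \<beta>) / 2) / Suc n" for n
  have \<gamma>: "\<beta> < \<gamma> n" "\<gamma> n < q" for n
  proof -
    define \<delta> where "\<delta> = (q - \<beta>) / 2 / Suc n"
    have "\<delta> \<le> (q - \<beta>) / 2 / 1" unfolding \<delta>_def using ord by (intro divide_left_mono) auto
    moreover have "\<delta> > 0" using ord by (simp add: \<delta>_def)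
    ultimately show "\<beta> < \<gamma> n" "\<gamma> n < q" using ord unfolding \<gamma>_def \<delta>_def[symmetric] by auto
  qed
  have \<gamma>_lim: "\<gamma> \<longlonglongrightarrow> \<beta>"
  proof -
    have "(\<lambda>n. \<beta> + ((q - \<beta>) / 2) / Suc n) \<longlonglongrightarrow> \<beta> + 0"
      by (intro tendsto_intros LIMSEQ_Suc[OF lim_const_over_n])
    then show ?thesis by (simp add: \<gamma>_def[abs_def])
  qed
  note iw = weak_deriv_integrable(2)[OF wd(2) sub]
  have iw': "set_integrable lborel {\<alpha>..q} (\<lambda>x. \<bar>w x\<bar>)" by (rule set_integrable_abs[OF iw])
  have tent_m: "tent \<alpha> \<beta> y \<in> borel_measurable borel" for y unfolding tent_def[abs_def] by measurable
  have tent_c: "continuous_on UNIV (tent \<alpha> \<beta> y)" for y unfolding tent_def[abs_def] by (intro continuous_intros)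
  have tent_b: "0 \<le> tent \<alpha> \<beta> (\<gamma> n) x" "tent \<alpha> \<beta> (\<gamma> n) x \<le> 1" if "x \<in> {\<alpha>..q}" for n x
  proof -
    have "0 \<le> tent \<alpha> \<beta> (\<gamma> n) x \<and> tent \<alpha> \<beta> (\<gamma> n) x \<le> 1"
      using tent_simps[OF ord(1) \<gamma>(1)[of n], of x] that ord \<gamma>(1)[of n]
      by (cases "x \<le> \<beta>"; cases "x \<le> \<gamma> n") auto
    then show "0 \<le> tent \<alpha> \<beta> (\<gamma> n) x" "tent \<alpha> \<beta> (\<gamma> n) x \<le> 1" by auto
  qed
  \<comment> \<open>Maximality at \<beta> makes the right difference quotient nonpositive, so the
    left one is at most minus the integral of \<open>w\<close> against the tent.\<close>
  have le: "(d \<beta> - d \<alpha>) / (\<beta> - \<alpha>) \<le> (LINT x:{\<alpha>..q}|lborel. \<bar>w x\<bar> * tent \<alpha> \<beta> (\<gamma> n) x)" for n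
  proof -
    have "(d (\<gamma> n) - d \<beta>) / (\<gamma> n - \<beta>) \<le> 0"
      using max[of "\<gamma> n"] \<gamma>[of n] by (simp add: divide_nonpos_pos)
    then have "(d \<beta> - d \<alpha>) / (\<beta> - \<alpha>) \<le> - (LINT x:{\<alpha>..q}|lborel. w x * tent \<alpha> \<beta> (\<gamma> n) x)"
      using second_difference_tent[OF ord(1) \<gamma>[of n] sub wd d] by simp
    also have "\<dots> \<le> \<bar>LINT x:{\<alpha>..q}|lborel. w x * tent \<alpha> \<beta> (\<gamma> n) x\<bar>" by simp
    also have "\<dots> \<le> (LINT x:{\<alpha>..q}|lborel. \<bar>w x * tent \<alpha> \<beta> (\<gamma> n) x\<bar>)"
      using set_integral_norm_bound[OF set_integrable_mult_continuous[OF iw tent_c]] by simp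
    also have "\<dots> = (LINT x:{\<alpha>..q}|lborel. \<bar>w x\<bar> * tent \<alpha> \<beta> (\<gamma> n) x)"
      by (rule set_lebesgue_integral_cong) (use tent_b in \<open>auto simp: abs_mult\<close>)
    finally show ?thesis .
  qed
  \<comment> \<open>As \<open>\<gamma> n\<close> decreases to \<beta> the right flank disappears and
    only the rising flank remains in the limit.\<close>
  have "(\<lambda>n. LINT x:{\<alpha>..q}|lborel. \<bar>w x\<bar> * tent \<alpha> \<beta> (\<gamma> n) x) \<longlonglongrightarrow>
      (LINT x:{\<alpha>..q}|lborel. \<bar>w x\<bar> * (indicator {..\<beta>} x * ((x - \<alpha>) / (\<beta> - \<alpha>))))"
  proof (rule tendsto_set_integral_mult[OF iw' tent_m, where B = 1])
    show "\<bar>tent \<alpha> \<beta> (\<gamma> n) x\<bar> \<le> 1" if "x \<in> {\<alpha>..q}" for n x using tent_b[OF that, of n] by simp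
    fix x assume x: "x \<in> {\<alpha>..q}"
    show "(\<lambda>n. tent \<alpha> \<beta> (\<gamma> n) x) \<longlonglongrightarrow> indicator {..\<beta>} x * ((x - \<alpha>) / (\<beta> - \<alpha>))"
    proof (cases "x \<le> \<beta>")
      case True
      then show ?thesis using x tent_simps(1)[OF ord(1) \<gamma>(1)] by simp
    next
      case False
      then have "\<forall>\<^sub>F n in sequentially. \<gamma> n < x" using order_tendstoD(2)[OF \<gamma>_lim] by simp
      then have "\<forall>\<^sub>F n in sequentially. tent \<alpha> \<beta> (\<gamma> n) x = 0"
        by (rule eventually_mono) (use tent_simps(3)[OF ord(1) \<gamma>(1)] in simp)
      then show ?thesis using False by (simp add: tendsto_eventually)
    qed
  qed measurable
  then have "(d \<beta> - d \<alpha>) / (\<beta> - \<alpha>) \<le>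
      (LINT x:{\<alpha>..q}|lborel. \<bar>w x\<bar> * (indicator {..\<beta>} x * ((x - \<alpha>) / (\<beta> - \<alpha>))))"
    by (rule LIMSEQ_le_const) (use le in blast)
  also have "\<dots> = (LINT x:{\<alpha>..\<beta>}|lborel. ((x - \<alpha>) * \<bar>w x\<bar>) / (\<beta> - \<alpha>))"
    unfolding set_lebesgue_integral_def
    by (rule Bochner_Integration.integral_cong) (use ord in \<open>auto split: split_indicator\<close>)
  also have "\<dots> = (LINT x:{\<alpha>..\<beta>}|lborel. (x - \<alpha>) * \<bar>w x\<bar>) / (\<beta> - \<alpha>)" by simp
  finally show ?thesis using ord by (simp add: divide_le_cancel)
qed

section \<open>The maximal slope of a time slice\<close>

lemma nn_integral_FTC_Icc_within:
  fixes f F :: "real \<Rightarrow> real"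
  assumes "\<alpha> \<le> \<beta>" and f: "continuous_on {\<alpha>..\<beta>} f" "\<And>x. x \<in> {\<alpha>..\<beta>} \<Longrightarrow> 0 \<le> f x"
    and F: "\<And>x. x \<in> {\<alpha>..\<beta>} \<Longrightarrow> (F has_real_derivative f x) (at x within {\<alpha>..\<beta>})"
  shows "(\<integral>\<^sup>+x\<in>{\<alpha>..\<beta>}. ennreal (f x) \<partial>lborel) = ennreal (F \<beta> - F \<alpha>)"
proof -
  have "(\<integral>\<^sup>+x\<in>{\<alpha>..\<beta>}. ennreal (f x) \<partial>lborel) = (\<integral>\<^sup>+x. ennreal (indicator {\<alpha>..\<beta>} x *\<^sub>R f x) \<partial>lborel)"
    by (intro nn_integral_cong) (auto split: split_indicator)
  also have "\<dots> = ennreal (LBINT x. indicator {\<alpha>..\<beta>} x *\<^sub>R f x)"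
    using borel_integrable_atLeastAtMost'[OF f(1)] f(2)
    by (intro nn_integral_eq_integral) (auto simp: set_integrable_def split: split_indicator)
  also have "(LBINT x. indicator {\<alpha>..\<beta>} x *\<^sub>R f x) = F \<beta> - F \<alpha>"
    by (rule integral_FTC_atLeastAtMost)
       (use assms in \<open>auto simp: has_real_derivative_iff_has_vector_derivative\<close>)
  finally show ?thesis .
qed

text \<open>The integrand is split as sqrt(m) |w| times (x - \<alpha>) / sqrt(m). Each factor
  carries its own indicator, because \<open>w\<close> and \<open>m\<close> are controlled only on
  the interval.\<close>

lemma weighted_Cauchy_Schwarz:
  fixes w m :: "real \<Rightarrow> real"
  assumes w: "set_integrable lborel {\<alpha>..\<beta>} w" and m: "continuous_on {\<alpha>..\<beta>} m"
    and pos: "\<And>x. x \<in> {\<alpha>..\<beta>} \<Longrightarrow> 0 < m x"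
  shows "(ennreal (LINT x:{\<alpha>..\<beta>}|lborel. (x - \<alpha>) * \<bar>w x\<bar>))\<^sup>2 \<le>
    (\<integral>\<^sup>+x\<in>{\<alpha>..\<beta>}. ennreal (m x * (w x)\<^sup>2) \<partial>lborel) * (\<integral>\<^sup>+x\<in>{\<alpha>..\<beta>}. ennreal ((x - \<alpha>)\<^sup>2 / m x) \<partial>lborel)"
proof -
  define f where "f x = ennreal ((indicator {\<alpha>..\<beta>} x *\<^sub>R sqrt (m x)) * \<bar>indicator {\<alpha>..\<beta>} x *\<^sub>R w x\<bar>)" for x
  define g where "g x = ennreal (indicator {\<alpha>..\<beta>} x *\<^sub>R ((x - \<alpha>) / sqrt (m x)))" for x
  have [measurable]: "(\<lambda>x. indicator {\<alpha>..\<beta>} x *\<^sub>R sqrt (m x)) \<in> borel_measurable borel"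
    by (rule borel_measurable_continuous_on_indicator) (auto intro!: continuous_intros m)
  have [measurable]: "(\<lambda>x. indicator {\<alpha>..\<beta>} x *\<^sub>R ((x - \<alpha>) / sqrt (m x))) \<in> borel_measurable borel"
    by (rule borel_measurable_continuous_on_indicator) (use pos in \<open>force intro!: continuous_intros m\<close>)+
  have [measurable]: "(\<lambda>x. indicator {\<alpha>..\<beta>} x *\<^sub>R w x) \<in> borel_measurable borel"
    using w by (auto simp: set_integrable_def)
  have fm: "f \<in> borel_measurable lborel" and gm: "g \<in> borel_measurable lborel"
    unfolding f_def[abs_def] g_def[abs_def] by measurable
  have i: "set_integrable lborel {\<alpha>..\<beta>} (\<lambda>x. \<bar>w x\<bar> * (x - \<alpha>))"
    by (rule set_integrable_mult_continuous[OF set_integrable_abs[OF w]]) (intro continuous_intros)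
  have fg: "f x * g x = ennreal (indicator {\<alpha>..\<beta>} x *\<^sub>R (\<bar>w x\<bar> * (x - \<alpha>)))" for x
    using pos[of x] by (auto simp: f_def g_def ennreal_mult[symmetric] split: split_indicator)
  have "(\<integral>\<^sup>+x. f x * g x \<partial>lborel) = ennreal (LBINT x. indicator {\<alpha>..\<beta>} x *\<^sub>R (\<bar>w x\<bar> * (x - \<alpha>)))"
    unfolding fg using i
    by (intro nn_integral_eq_integral) (auto simp: set_integrable_def split: split_indicator)
  also have "\<dots> = ennreal (LINT x:{\<alpha>..\<beta>}|lborel. (x - \<alpha>) * \<bar>w x\<bar>)"
    by (simp add: set_lebesgue_integral_def mult.commute)
  finally have 1: "(\<integral>\<^sup>+x. f x * g x \<partial>lborel) = ennreal (LINT x:{\<alpha>..\<beta>}|lborel. (x - \<alpha>) * \<bar>w x\<bar>)" .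
  have f2: "f x ^ 2 = ennreal (m x * (w x)\<^sup>2) * indicator {\<alpha>..\<beta>} x" for x
    using pos[of x] by (auto simp: f_def ennreal_power power_mult_distrib split: split_indicator)
  have g2: "g x ^ 2 = ennreal ((x - \<alpha>)\<^sup>2 / m x) * indicator {\<alpha>..\<beta>} x" for x
    using pos[of x] by (auto simp: g_def ennreal_power power_divide split: split_indicator)
  show ?thesis using Cauchy_Schwarz_nn_integral[OF fm gm] unfolding 1 f2 g2 .
qed

section \<open>The mobility and its logarithmic integral\<close>

lemma mobility_pos: "\<epsilon> > 0 \<Longrightarrow> s > 0 \<Longrightarrow> mobility n \<epsilon> s > 0"
  by (simp add: mobility_def add_pos_pos)

lemma continuous_on_mobility:
  assumes "continuous_on A v" "\<And>x. x \<in> A \<Longrightarrow> v x > 0"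
  shows "continuous_on A (\<lambda>x. mobility n \<epsilon> (v x))"
  unfolding mobility_def using assms by (intro continuous_intros) (force dest: less_imp_neq)+

text \<open>With p = 3 - n the mobility is s^n (\<epsilon>^p + s^p), so s^2 divided by it equals
  s^(p-1) / (\<epsilon>^p + s^p), a logarithmic derivative up to the factor p.\<close>

lemma mobility_antideriv:
  assumes "\<epsilon> > 0" "n < 3" "s > 0"
  shows "((\<lambda>s. ln (\<epsilon> powr (3 - n) + s powr (3 - n)) / (3 - n)) has_real_derivative s\<^sup>2 / mobility n \<epsilon> s) (at s)"
proof -
  have pos: "\<epsilon> powr (3 - n) + s powr (3 - n) > 0" using assms by (simp add: add_pos_pos)
  have e: "s powr (3 - n - 1) * s powr n = s\<^sup>2" "s powr (3 - n - 1) * s ^ 3 = s\<^sup>2 * s powr (3 - n)"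
    using assms(3) by (simp_all flip: powr_add powr_numeral)
  have "s powr (3 - n - 1) / (\<epsilon> powr (3 - n) + s powr (3 - n)) = s\<^sup>2 / mobility n \<epsilon> s"
    using pos mobility_pos[OF assms(1,3), of n] e
    by (simp add: mobility_def frac_eq_eq algebra_simps)
  moreover have "((\<lambda>s. ln (\<epsilon> powr p + s powr p) / p) has_real_derivative
      s powr (p - 1) / (\<epsilon> powr p + s powr p)) (at s)" if "p > 0" "\<epsilon> powr p + s powr p > 0" for p
  proof -
    have "((\<lambda>s. ln (\<epsilon> powr p + s powr p) / p) has_real_derivative
        (1 / (\<epsilon> powr p + s powr p) * (0 + p * s powr (p - 1))) / p) (at s)"
      by (intro DERIV_cdivide DERIV_chain2[OF DERIV_ln_divide] DERIV_add DERIV_const has_real_derivative_powr that assms)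
    then show ?thesis using that by simp
  qed
  from this[of "3 - n"] have "((\<lambda>s. ln (\<epsilon> powr (3 - n) + s powr (3 - n)) / (3 - n)) has_real_derivative
      s powr (3 - n - 1) / (\<epsilon> powr (3 - n) + s powr (3 - n))) (at s)"
    using assms pos by simp
  ultimately show ?thesis by simp
qed

text \<open>Above, \<epsilon>^p + s^p is at most 2 (\<epsilon> + s)^p and ln(\<epsilon> + s) is at
  most \<open>K\<close>. Below, dropping r^p leaves p ln \<epsilon>, whatever the size of
  \<open>r\<close>. This lower bound contributes one multiple of the logarithm of
  \<epsilon>.\<close>

lemma log_mobility_bound:
  fixes \<epsilon> n s r K :: real
  assumes \<epsilon>: "0 < \<epsilon>" "\<epsilon> \<le> 1/2" and "n < 3" "0 < s" "0 < r" "s \<le> K"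
  shows "ln (\<epsilon> powr (3 - n) + s powr (3 - n)) / (3 - n) - ln (\<epsilon> powr (3 - n) + r powr (3 - n)) / (3 - n)
    \<le> \<bar>ln \<epsilon>\<bar> * (1 + (3 - n) + (3 - n) * K / ln 2) / (3 - n)"
proof -
  define p where "p = 3 - n"
  have p: "p > 0" using assms by (simp add: p_def)
  have L: "\<bar>ln \<epsilon>\<bar> = - ln \<epsilon>" using \<epsilon> by simp
  have "ln \<epsilon> \<le> ln (1/2)" using \<epsilon> by (subst ln_le_cancel_iff) auto
  then have L2: "\<bar>ln \<epsilon>\<bar> \<ge> ln 2" using L by (simp add: ln_div)
  have "\<epsilon> powr p + s powr p \<le> 2 * (\<epsilon> + s) powr p"
    using powr_mono2[of p \<epsilon> "\<epsilon> + s"] powr_mono2[of p s "\<epsilon> + s"] p assms by simp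
  then have "ln (\<epsilon> powr p + s powr p) \<le> ln (2 * (\<epsilon> + s) powr p)"
    using assms by (subst ln_le_cancel_iff) (auto simp: add_pos_pos)
  also have "\<dots> = ln 2 + p * ln (\<epsilon> + s)" using assms by (simp add: ln_mult ln_powr)
  also have "ln (\<epsilon> + s) \<le> ln (1 + s)" using assms by (subst ln_le_cancel_iff) auto
  also have "ln (1 + s) \<le> K" using ln_add_one_self_le_self[of s] assms by simp
  finally have 1: "ln (\<epsilon> powr p + s powr p) \<le> ln 2 + p * K" using p by simp
  have "p * ln \<epsilon> = ln (\<epsilon> powr p)" using \<epsilon> by (simp add: ln_powr)
  also have "\<dots> \<le> ln (\<epsilon> powr p + r powr p)" using assms by (subst ln_le_cancel_iff) (auto simp: add_pos_pos)
  finally have 2: "p * ln \<epsilon> \<le> ln (\<epsilon> powr p + r powr p)" .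
  \<comment> \<open>Since \<epsilon> is at most 1/2, ln 2 is at most
    \<open>\<bar>ln \<epsilon>\<bar>\<close>, so terms independent of \<epsilon> can be absorbed
    into multiples of this logarithm.\<close>
  have "p * K = ln 2 * (p * K / ln 2)" by simp
  also have "\<dots> \<le> \<bar>ln \<epsilon>\<bar> * (p * K / ln 2)" using L2 p assms by (intro mult_right_mono) auto
  finally have "ln (\<epsilon> powr p + s powr p) - ln (\<epsilon> powr p + r powr p) \<le> \<bar>ln \<epsilon>\<bar> * (1 + p + p * K / ln 2)"
    using 1 2 L L2 by (simp add: algebra_simps)
  then show ?thesis using p unfolding p_def[symmetric] by (simp add: diff_divide_distrib[symmetric] divide_right_mono)
qed

text \<open>The first summand covers the slices with \<open>M > 1 / (2 l\<^sup>2)\<close> in \<open>slice_integral_bound\<close> below, the second one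
  the slices with smaller slopes, on which the unit mass keeps \<open>v\<close> away from zero.\<close>

definition slope_const :: "real \<Rightarrow> real \<Rightarrow> real" where
  "slope_const n l = (32 / (3 - n)) * ((1 + (3 - n)) * (2 * l\<^sup>2) + 3 * (3 - n) * l / ln 2) + 8 * l\<^sup>2 / ln 2"

text \<open>The combination \<open>4 * M\<^sup>2 * J\<close> is the one used later: multiplying
  M^2/4 \<le> J D by 4 M^2, where D is the dissipation on the interval, gives M^4 \<le> 4 M^2 J D.
  The bounds \<open>vb\<close> encode unit mass together with the slope bound.\<close>

lemma slice_integral_bound:
  fixes v d :: "real \<Rightarrow> real"
  assumes ord: "\<alpha> < \<beta>" "\<beta> - \<alpha> \<le> l" and \<epsilon>: "0 < \<epsilon>" "\<epsilon> \<le> 1/2" and n: "n < 3"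
    and vpos: "\<And>x. x \<in> {\<alpha>..\<beta>} \<Longrightarrow> 0 < v x"
    and v: "\<And>x. x \<in> {\<alpha>..\<beta>} \<Longrightarrow> (v has_real_derivative d x) (at x within {\<alpha>..\<beta>})"
    and d: "continuous_on {\<alpha>..\<beta>} d" "\<And>x. x \<in> {\<alpha>..\<beta>} \<Longrightarrow> M / 2 \<le> d x"
    and M: "0 < M"
    and vb: "\<And>x. x \<in> {\<alpha>..\<beta>} \<Longrightarrow> 1 / l - M * l \<le> v x" "\<And>x. x \<in> {\<alpha>..\<beta>} \<Longrightarrow> v x \<le> 1 / l + M * l"
  shows "\<exists>J\<ge>0. 4 * M\<^sup>2 * J \<le> slope_const n l \<and>
    (\<integral>\<^sup>+x\<in>{\<alpha>..\<beta>}. ennreal ((x - \<alpha>)\<^sup>2 / (\<bar>ln \<epsilon>\<bar> * mobility n \<epsilon> (v x))) \<partial>lborel) \<le> ennreal J"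
proof -
  have l: "l > 0" using ord by simp
  define p where "p = 3 - n"
  have p: "p > 0" using n by (simp add: p_def)
  define L where "L = \<bar>ln \<epsilon>\<bar>"
  have "ln \<epsilon> \<le> ln (1/2)" using \<epsilon> by (subst ln_le_cancel_iff) auto
  then have L: "L \<ge> ln 2" using \<epsilon> by (simp add: ln_div L_def)
  have ln2: "ln 2 > (0::real)" by simp
  then have L0: "L > 0" using L by linarith
  have cv: "continuous_on {\<alpha>..\<beta>} v" using v by (rule DERIV_continuous_on)
  have mob: "mobility n \<epsilon> (v x) > 0" if "x \<in> {\<alpha>..\<beta>}" for x using mobility_pos[OF \<epsilon>(1) vpos[OF that]] .
  have C: "slope_const n l = (32 / p) * ((1 + p) * (2 * l\<^sup>2) + 3 * p * l / ln 2) + 8 * l\<^sup>2 / ln 2"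
    by (simp add: slope_const_def p_def)
  show ?thesis
  proof (cases "M \<le> 1 / (2 * l\<^sup>2)")
    case True
    have v_lower: "v x \<ge> 1 / (2 * l)" if "x \<in> {\<alpha>..\<beta>}" for x
    proof -
      have "M * l \<le> 1 / (2 * l\<^sup>2) * l" using True l by (intro mult_right_mono) auto
      also have "\<dots> = 1 / (2 * l)" using l by (simp add: power2_eq_square)
      finally show ?thesis using vb(1)[OF that] l by (simp add: field_simps)
    qed
    \<comment> \<open>The interval length, at most \<open>l\<close>, times the pointwise bound 8 l^5
      / ln 2 proved next. With M \<le> 1/(2 l^2), 4 M^2 J is at most the second summand of
      \<open>slope_const\<close>.\<close>
    define J where "J = 8 * l ^ 6 / ln 2"
    have pt: "(x - \<alpha>)\<^sup>2 / (L * mobility n \<epsilon> (v x)) \<le> 8 * l ^ 5 / ln 2" if x: "x \<in> {\<alpha>..\<beta>}" for x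
    proof -
      have "(1 / (2 * l)) ^ 3 \<le> v x ^ 3" using v_lower[OF x] l by (intro power_mono) auto
      also have "\<dots> \<le> mobility n \<epsilon> (v x)" by (simp add: mobility_def)
      finally have m: "(1 / (2 * l)) ^ 3 \<le> mobility n \<epsilon> (v x)" .
      have "(x - \<alpha>)\<^sup>2 / (L * mobility n \<epsilon> (v x)) \<le> l\<^sup>2 / (ln 2 * (1 / (2 * l)) ^ 3)"
        using x ord l L L0 m by (intro frac_le power_mono mult_mono) auto
      also have "\<dots> = 8 * l ^ 5 / ln 2" using l by (simp add: power_divide power_mult_distrib field_simps eval_nat_numeral)
      finally show ?thesis .
    qed
    have "(\<integral>\<^sup>+x\<in>{\<alpha>..\<beta>}. ennreal ((x - \<alpha>)\<^sup>2 / (L * mobility n \<epsilon> (v x))) \<partial>lborel)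
        \<le> (\<integral>\<^sup>+x\<in>{\<alpha>..\<beta>}. ennreal (8 * l ^ 5 / ln 2) \<partial>lborel)"
      by (intro nn_integral_mono) (auto split: split_indicator intro!: ennreal_leI pt)
    also have "\<dots> = ennreal (8 * l ^ 5 / ln 2) * ennreal (\<beta> - \<alpha>)"
      using ord by (simp add: nn_integral_cmult_indicator)
    also have "\<dots> \<le> ennreal (8 * l ^ 5 / ln 2) * ennreal l" using ord by (intro mult_left_mono ennreal_leI) auto
    also have "\<dots> = ennreal J" using l by (simp add: J_def ennreal_mult[symmetric] eval_nat_numeral)
    finally have 1: "(\<integral>\<^sup>+x\<in>{\<alpha>..\<beta>}. ennreal ((x - \<alpha>)\<^sup>2 / (L * mobility n \<epsilon> (v x))) \<partial>lborel) \<le> ennreal J" .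
    have "M\<^sup>2 \<le> (1 / (2 * l\<^sup>2))\<^sup>2" using True M by (intro power_mono) auto
    then have "4 * M\<^sup>2 * J \<le> 4 * (1 / (2 * l\<^sup>2))\<^sup>2 * J" using l by (intro mult_right_mono) (auto simp: J_def)
    also have "\<dots> = 8 * l\<^sup>2 / ln 2" using l by (simp add: J_def power_divide field_simps eval_nat_numeral)
    also have "\<dots> \<le> slope_const n l" unfolding C using p l ln2 by simp
    finally have "4 * M\<^sup>2 * J \<le> slope_const n l" .
    moreover have "J \<ge> 0" using l by (simp add: J_def)
    ultimately show ?thesis using 1 unfolding L_def by blast
  next
    case False
    define G where "G s = ln (\<epsilon> powr p + s powr p) / p" for s
    \<comment> \<open>In this regime 1/l \<le> 2 l M, so the upper bound 1/l + M l for
      \<open>v\<close> is at most 3 l M.\<close>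
    define K where "K = 3 * l * M"
    have G': "(G has_real_derivative s\<^sup>2 / mobility n \<epsilon> s) (at s)" if "s > 0" for s
      using mobility_antideriv[OF \<epsilon>(1) n that] by (simp add: G_def[abs_def] p_def)
    \<comment> \<open>Squaring x - \<alpha> \<le> 2 v / M gives 4/M^2, and inserting 1 \<le> 2 d / M
      gives another 2/M. The inserted \<open>d\<close> makes \<open>f\<close> the exact derivative
      of \<open>c * G (v x)\<close>.\<close>
    define c where "c = 8 / (M ^ 3 * L)"
    have c: "c > 0" using M L0 by (simp add: c_def)
    define f where "f x = c * ((v x)\<^sup>2 / mobility n \<epsilon> (v x) * d x)" for x
    have v_ge: "(M / 2) * (x - \<alpha>) \<le> v x" if x: "x \<in> {\<alpha>..\<beta>}" for x
    proof -
      have "v \<alpha> - (M / 2) * \<alpha> \<le> v x - (M / 2) * x"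
      proof (rule DERIV_nonneg_imp_increasing_open[of \<alpha> x "\<lambda>x. v x - (M / 2) * x"])
        show "\<exists>z. ((\<lambda>x. v x - (M / 2) * x) has_real_derivative z) (at y) \<and> 0 \<le> z" if y: "\<alpha> < y" "y < x" for y
        proof -
          have "(v has_real_derivative d y) (at y)"
            using v[of y] x y by (simp add: at_within_Icc_at)
          then have "((\<lambda>x. v x - (M / 2) * x) has_real_derivative d y - M / 2) (at y)"
            by (auto intro!: derivative_eq_intros)
          then show ?thesis using d(2)[of y] x y by force
        qed
        show "continuous_on {\<alpha>..x} (\<lambda>x. v x - (M / 2) * x)"
          using x by (intro continuous_intros continuous_on_subset[OF cv]) auto
      qed (use x in simp)
      then show ?thesis using vpos[of \<alpha>] ord by (simp add: algebra_simps)
    qed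
    have pt: "(x - \<alpha>)\<^sup>2 / (L * mobility n \<epsilon> (v x)) \<le> f x" if x: "x \<in> {\<alpha>..\<beta>}" for x
    proof -
      have "x - \<alpha> \<le> 2 * v x / M" using v_ge[OF x] M by (simp add: field_simps)
      then have "(x - \<alpha>)\<^sup>2 \<le> (2 * v x / M)\<^sup>2" using x by (intro power_mono) auto
      also have "\<dots> = (8 / M ^ 3) * (v x)\<^sup>2 * (M / 2)" using M by (simp add: field_simps eval_nat_numeral)
      also have "\<dots> \<le> (8 / M ^ 3) * (v x)\<^sup>2 * d x" using M d(2)[OF x] by (intro mult_left_mono) auto
      finally have "(x - \<alpha>)\<^sup>2 / (L * mobility n \<epsilon> (v x)) \<le> (8 / M ^ 3) * (v x)\<^sup>2 * d x / (L * mobility n \<epsilon> (v x))"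
        using mob[OF x] L0 by (intro divide_right_mono) auto
      then show ?thesis by (simp add: f_def c_def)
    qed
    have "(\<integral>\<^sup>+x\<in>{\<alpha>..\<beta>}. ennreal ((x - \<alpha>)\<^sup>2 / (L * mobility n \<epsilon> (v x))) \<partial>lborel)
        \<le> (\<integral>\<^sup>+x\<in>{\<alpha>..\<beta>}. ennreal (f x) \<partial>lborel)"
      by (intro nn_integral_mono) (auto split: split_indicator intro!: ennreal_leI pt)
    also have "\<dots> = ennreal (c * G (v \<beta>) - c * G (v \<alpha>))"
    proof (rule nn_integral_FTC_Icc_within)
      show "continuous_on {\<alpha>..\<beta>} f"
        unfolding f_def[abs_def] using mob
        by (intro continuous_intros cv d(1) continuous_on_mobility vpos) (force dest: less_imp_neq)+
      show "0 \<le> f x" if "x \<in> {\<alpha>..\<beta>}" for x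
        using d(2)[OF that] mob[OF that] M c by (simp add: f_def)
      show "((\<lambda>x. c * G (v x)) has_real_derivative f x) (at x within {\<alpha>..\<beta>})" if "x \<in> {\<alpha>..\<beta>}" for x
        unfolding f_def by (intro DERIV_cmult DERIV_chain2[OF G'[OF vpos[OF that]] v[OF that]])
    qed (use ord in simp)
    also have "\<dots> \<le> ennreal (c * (L * (1 + p + p * K / ln 2) / p))"
    proof (rule ennreal_leI)
      have "1 / l = 2 * l * (1 / (2 * l\<^sup>2))" using l by (simp add: power2_eq_square)
      also have "\<dots> \<le> 2 * l * M" using False l by (intro mult_left_mono) auto
      finally have "v \<beta> \<le> K" using vb(2)[of \<beta>] ord by (simp add: K_def algebra_simps)
      then have "G (v \<beta>) - G (v \<alpha>) \<le> L * (1 + p + p * K / ln 2) / p"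
        using log_mobility_bound[OF \<epsilon> n vpos vpos, of \<beta> \<alpha> K] ord unfolding G_def L_def p_def by simp
      then show "c * G (v \<beta>) - c * G (v \<alpha>) \<le> c * (L * (1 + p + p * K / ln 2) / p)"
        unfolding right_diff_distrib[symmetric] using c by (intro mult_left_mono) auto
    qed
    finally have 1: "(\<integral>\<^sup>+x\<in>{\<alpha>..\<beta>}. ennreal ((x - \<alpha>)\<^sup>2 / (L * mobility n \<epsilon> (v x))) \<partial>lborel)
        \<le> ennreal (c * (L * (1 + p + p * K / ln 2) / p))" .
    \<comment> \<open>The logarithm cancels against \<open>c\<close>. One term keeps a factor 1/M,
      at most 2 l^2 here; in the other the M inside \<open>K\<close> cancels it.\<close>
    have "4 * M\<^sup>2 * (c * (L * (1 + p + p * K / ln 2) / p)) = (32 / p) * ((1 + p) * (1 / M) + 3 * p * l / ln 2)"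
      using M L0 p by (simp add: c_def K_def field_simps eval_nat_numeral)
    also have "\<dots> \<le> (32 / p) * ((1 + p) * (2 * l\<^sup>2) + 3 * p * l / ln 2)"
    proof -
      have "1 / M \<le> 2 * l\<^sup>2" using False M l by (simp add: field_simps)
      then show ?thesis using p by (intro mult_left_mono add_right_mono) auto
    qed
    also have "\<dots> \<le> slope_const n l" unfolding C using ln2 by simp
    finally have "4 * M\<^sup>2 * (c * (L * (1 + p + p * K / ln 2) / p)) \<le> slope_const n l" .
    moreover have "c * (L * (1 + p + p * K / ln 2) / p) \<ge> 0" using c L0 p l M by (simp add: K_def)
    ultimately show ?thesis using 1 unfolding L_def by blast
  qed
qed

text \<open>Here the largest absolute slope is attained with positive sign. The dissipation is taken
  over a compact interval of positivity, where \<open>w\<close> is integrable; this supplies the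
  measurability needed to reflect the estimate in \<open>max_slope_bound\<close>.\<close>

lemma max_slope_bound_pos:
  fixes a b n \<epsilon> x0 :: real and v d g h w :: "real \<Rightarrow> real"
  assumes ab: "a < b" and \<epsilon>: "0 < \<epsilon>" "\<epsilon> \<le> 1/2" and n: "n < 3"
    and v: "\<And>x. x \<in> {a..b} \<Longrightarrow> (v has_real_derivative d x) (at x within {a..b})"
    and d: "continuous_on {a..b} d" "d a = 0" "d b = 0"
    and nonneg: "\<And>x. x \<in> {a..b} \<Longrightarrow> 0 \<le> v x" and mass: "(LINT x:{a<..<b}|lborel. v x) = 1"
    and gd: "AE x in lborel. x \<in> {a<..<b} \<longrightarrow> g x = d x"
    and wd: "weak_deriv (pos_set a b v) g h" "weak_deriv (pos_set a b v) h w"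
    and x0: "x0 \<in> {a..b}" "\<And>x. x \<in> {a..b} \<Longrightarrow> \<bar>d x\<bar> \<le> d x0"
  shows "\<exists>\<alpha> \<beta>. {\<alpha>..\<beta>} \<subseteq> pos_set a b v \<and> ennreal (d x0 ^ 4) \<le> ennreal (slope_const n (b - a)) *
      (\<integral>\<^sup>+x\<in>{\<alpha>..\<beta>}. ennreal (\<bar>ln \<epsilon>\<bar> * mobility n \<epsilon> (v x) * (w x)\<^sup>2) \<partial>lborel)"
proof (cases "d x0 = 0")
  case True
  \<comment> \<open>The interval from 1 to 0 is empty, and the left side is zero.\<close>
  then show ?thesis by (intro exI[of _ 1] exI[of _ 0]) simp
next
  case False
  define M where "M = d x0"
  have M: "M > 0" using x0(2)[OF x0(1)] False by (simp add: M_def)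
  define l where "l = b - a"
  have l: "l > 0" using ab by (simp add: l_def)
  have x0': "a < x0" "x0 < b" using x0(1) d(2,3) False by (metis atLeastAtMost_iff less_eq_real_def)+
  have cv: "continuous_on {a..b} v" using v by (rule DERIV_continuous_on)
  \<comment> \<open>An interior zero of the nonnegative \<open>v\<close> is a minimum, so the slope
    vanishes there.\<close>
  have vpos: "0 < v x" if x: "a < x" "x < b" "d x \<noteq> 0" for x
  proof (rule ccontr)
    assume "\<not> 0 < v x"
    then have "v x = 0" using nonneg[of x] x by simp
    have D: "(v has_real_derivative d x) (at x)" using v[of x] x by (simp add: at_within_Icc_at)
    have "\<forall>y. \<bar>x - y\<bar> < min (x - a) (b - x) \<longrightarrow> v x \<le> v y"
      using nonneg \<open>v x = 0\<close> by (auto simp: abs_real_def split: if_splits)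
    from DERIV_local_min[OF D _ this] x have "d x = 0" by simp
    with x show False by simp
  qed
  \<comment> \<open>The maximum of this compact set is the last crossing of level M/2 before
    \<open>x0\<close>. By the intermediate value theorem, \<open>d\<close> stays above that level
    afterwards.\<close>
  define A where "A = {x \<in> {a..x0}. d x = M / 2}"
  have "\<exists>x\<ge>a. x \<le> x0 \<and> d x = M / 2"
    by (rule IVT') (use d M x0' in \<open>auto simp: M_def intro: continuous_on_subset\<close>)
  then have "A \<noteq> {}" by (auto simp: A_def)
  moreover have "compact A"
  proof -
    have "closed ({a..x0} \<inter> d -` {M / 2})"
      by (rule continuous_closed_preimage) (use d(1) x0' in \<open>auto intro: continuous_on_subset\<close>)
    then have "compact ({a..x0} \<inter> ({a..x0} \<inter> d -` {M / 2}))"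
      by (intro compact_Int_closed) auto
    also have "{a..x0} \<inter> ({a..x0} \<inter> d -` {M / 2}) = A" by (auto simp: A_def)
    finally show ?thesis .
  qed
  ultimately obtain \<alpha> where \<alpha>: "\<alpha> \<in> A" "\<And>x. x \<in> A \<Longrightarrow> x \<le> \<alpha>"
    using continuous_attains_sup[of A "\<lambda>x. x"] by (auto intro: continuous_intros)
  then have d\<alpha>: "d \<alpha> = M / 2" and "a \<le> \<alpha>" "\<alpha> \<le> x0" by (auto simp: A_def)
  then have \<alpha>': "a < \<alpha>" "\<alpha> < x0" using d(2) M by (auto simp: M_def less_eq_real_def)
  have dge: "M / 2 \<le> d x" if x: "x \<in> {\<alpha>..x0}" for x
  proof (rule ccontr)
    assume "\<not> M / 2 \<le> d x"
    then have "\<exists>y\<ge>x. y \<le> x0 \<and> d y = M / 2"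
      using x \<alpha>' x0' M by (intro IVT') (auto simp: M_def intro: continuous_on_subset[OF d(1)])
    then obtain y where "x \<le> y" "y \<le> x0" "d y = M / 2" by blast
    moreover from this have "y \<le> \<alpha>" using \<alpha>(2)[of y] x \<alpha>' by (simp add: A_def)
    ultimately have "x = \<alpha>" using x by simp
    then show False using d\<alpha> \<open>\<not> M / 2 \<le> d x\<close> by simp
  qed
  have vpos': "0 < v x" if "x \<in> {\<alpha>..x0}" for x
    using vpos[of x] dge[OF that] that \<alpha>' x0' M by auto
  \<comment> \<open>The narrowing right flanks of the tents need room to the right of
    \<open>x0\<close> inside the positivity set, where the weak derivatives are available.\<close>
  obtain q where q: "x0 < q" "q < b" "\<And>x. x \<in> {x0..q} \<Longrightarrow> 0 < v x"
  proof -
    have "(v has_real_derivative d x0) (at x0)" using v[OF x0(1)] x0' by (simp add: at_within_Icc_at)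
    then have "isCont v x0" by (rule DERIV_isCont)
    then have "\<forall>\<^sub>F x in at x0. 0 < v x"
      using order_tendstoD(1)[of v "v x0" "at x0" 0] vpos'[of x0] \<alpha>' by (simp add: isCont_def)
    then obtain \<delta> where \<delta>: "\<delta> > 0" "\<And>x. x \<noteq> x0 \<Longrightarrow> dist x x0 < \<delta> \<Longrightarrow> 0 < v x"
      by (auto simp: eventually_at)
    define q where "q = x0 + min (\<delta> / 2) ((b - x0) / 2)"
    show thesis
    proof (rule that[of q])
      show "x0 < q" "q < b" using \<delta>(1) x0' by (auto simp: q_def min_def field_simps)
      show "0 < v x" if "x \<in> {x0..q}" for x
        using \<delta>(2)[of x] \<delta>(1) vpos'[of x0] \<alpha>' that by (cases "x = x0") (auto simp: q_def dist_real_def)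
    qed
  qed
  have sub: "{\<alpha>..q} \<subseteq> pos_set a b v"
  proof
    fix x assume "x \<in> {\<alpha>..q}"
    then show "x \<in> pos_set a b v"
      using vpos'[of x] q(3)[of x] \<alpha>' q(1,2) by (cases "x \<le> x0") (auto simp: pos_set_def)
  qed
  have sub': "{\<alpha>..x0} \<subseteq> pos_set a b v" using sub q(1) by fastforce
  have ab_sub: "{\<alpha>..q} \<subseteq> {a<..<b}" "{\<alpha>..q} \<subseteq> {a..b}" "{\<alpha>..x0} \<subseteq> {a..b}" using \<alpha>' q x0' by auto
  have rise: "M / 2 \<le> (LINT x:{\<alpha>..x0}|lborel. (x - \<alpha>) * \<bar>w x\<bar>)"
  proof -
    have "d x0 - d \<alpha> \<le> (LINT x:{\<alpha>..x0}|lborel. (x - \<alpha>) * \<bar>w x\<bar>)"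
    proof (rule rise_to_max_le[OF \<alpha>'(2) q(1) sub wd])
      show "continuous_on {\<alpha>..q} d" by (rule continuous_on_subset[OF d(1) ab_sub(2)])
      show "AE x in lborel. x \<in> {\<alpha>..q} \<longrightarrow> g x = d x" using gd by (rule eventually_mono) (use ab_sub in blast)
      show "d x \<le> d x0" if "x \<in> {x0..q}" for x using x0(2)[of x] that q x0' by simp
    qed
    then show ?thesis using d\<alpha> by (simp add: M_def)
  qed
  have osc: "\<bar>v x - v y\<bar> \<le> M * l" if "x \<in> {a..b}" "y \<in> {a..b}" for x y
  proof -
    have "norm (v x - v y) \<le> M * norm (x - y)"
      by (rule field_differentiable_bound[of "{a..b}" v d]) (use v x0(2) that in \<open>auto simp: M_def\<close>)
    also have "\<dots> \<le> M * l" using M that by (intro mult_left_mono) (auto simp: l_def)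
    finally show ?thesis by simp
  qed
  have iv: "set_integrable lborel {a<..<b} v"
    by (rule set_integrable_subset[OF borel_integrable_atLeastAtMost'[OF cv]]) auto
  have ic: "set_integrable lborel {a<..<b} (\<lambda>_. c)" for c :: real
    by (rule set_integrable_subset[OF borel_integrable_atLeastAtMost'[of a b]]) (auto intro: continuous_intros)
  have cint: "(LINT y:{a<..<b}|lborel. c) = c * l" for c :: real
    using ab by (simp add: set_lebesgue_integral_def l_def)
  \<comment> \<open>The mean of \<open>v\<close> is 1/l, and every value differs from
    \<open>v x\<close> by at most M l.\<close>
  have vb: "1 / l - M * l \<le> v x" "v x \<le> 1 / l + M * l" if x: "x \<in> {a..b}" for x
  proof -
    have vy: "v y \<le> v x + M * l" "v x - M * l \<le> v y" if "y \<in> {a<..<b}" for y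
      using osc[OF x, of y] that by auto
    have "1 \<le> (LINT y:{a<..<b}|lborel. v x + M * l)"
      unfolding mass[symmetric] by (intro set_integral_mono iv ic vy)
    then have "1 / l \<le> v x + M * l" unfolding cint using l by (simp add: divide_le_eq)
    then show "1 / l - M * l \<le> v x" by simp
    have "(LINT y:{a<..<b}|lborel. v x - M * l) \<le> 1"
      unfolding mass[symmetric] by (intro set_integral_mono iv ic vy)
    then have "v x - M * l \<le> 1 / l" unfolding cint using l by (simp add: le_divide_eq)
    then show "v x \<le> 1 / l + M * l" by simp
  qed
  obtain J where J: "J \<ge> 0" "4 * M\<^sup>2 * J \<le> slope_const n l"
    "(\<integral>\<^sup>+x\<in>{\<alpha>..x0}. ennreal ((x - \<alpha>)\<^sup>2 / (\<bar>ln \<epsilon>\<bar> * mobility n \<epsilon> (v x))) \<partial>lborel) \<le> ennreal J"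
  proof -
    have "(v has_real_derivative d x) (at x within {\<alpha>..x0})" if "x \<in> {\<alpha>..x0}" for x
      using v[of x] ab_sub(3) that by (meson DERIV_subset subsetD)
    then show thesis
      using slice_integral_bound[of \<alpha> x0 l \<epsilon> n v d M] \<alpha>' x0' \<epsilon> n vpos' dge M vb ab_sub(3)
        continuous_on_subset[OF d(1) ab_sub(3)] that by (force simp: l_def)
  qed
  let ?D = "\<integral>\<^sup>+x\<in>{\<alpha>..x0}. ennreal (\<bar>ln \<epsilon>\<bar> * mobility n \<epsilon> (v x) * (w x)\<^sup>2) \<partial>lborel"
  have "ennreal ((M / 2)\<^sup>2) \<le> (ennreal (LINT x:{\<alpha>..x0}|lborel. (x - \<alpha>) * \<bar>w x\<bar>))\<^sup>2"
    using rise M by (simp add: ennreal_power[symmetric] power_mono ennreal_leI del: ennreal_power)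
  also have "\<dots> \<le> ?D * (\<integral>\<^sup>+x\<in>{\<alpha>..x0}. ennreal ((x - \<alpha>)\<^sup>2 / (\<bar>ln \<epsilon>\<bar> * mobility n \<epsilon> (v x))) \<partial>lborel)"
  proof (rule weighted_Cauchy_Schwarz)
    show "set_integrable lborel {\<alpha>..x0} w" by (rule weak_deriv_integrable(2)[OF wd(2) sub'])
    show "continuous_on {\<alpha>..x0} (\<lambda>x. \<bar>ln \<epsilon>\<bar> * mobility n \<epsilon> (v x))"
      by (intro continuous_intros continuous_on_mobility continuous_on_subset[OF cv ab_sub(3)] vpos')
    show "0 < \<bar>ln \<epsilon>\<bar> * mobility n \<epsilon> (v x)" if "x \<in> {\<alpha>..x0}" for x
      using mobility_pos[OF \<epsilon>(1) vpos'[OF that]] \<epsilon> by (intro mult_pos_pos) auto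
  qed
  also have "\<dots> \<le> ?D * ennreal J" using J(3) by (rule mult_left_mono) simp
  finally have 1: "ennreal ((M / 2)\<^sup>2) \<le> ?D * ennreal J" .
  have "ennreal (M ^ 4) = ennreal (4 * M\<^sup>2) * ennreal ((M / 2)\<^sup>2)"
    using M by (simp add: ennreal_mult[symmetric] power_divide eval_nat_numeral)
  also have "\<dots> \<le> ennreal (4 * M\<^sup>2) * (?D * ennreal J)" using 1 by (rule mult_left_mono) simp
  also have "\<dots> = ennreal (4 * M\<^sup>2 * J) * ?D" using J(1) by (simp add: ennreal_mult mult_ac)
  also have "\<dots> \<le> ennreal (slope_const n l) * ?D" using J(2) by (intro mult_right_mono ennreal_leI) auto
  finally show ?thesis using sub' by (auto simp: M_def l_def)
qed

section \<open>Reflection of the interval\<close>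

lemma locally_integrable_reflect:
  assumes "locally_integrable U f"
  shows "locally_integrable {x. - x \<in> U} (\<lambda>x. f (- x))"
  unfolding locally_integrable_def
proof (intro allI impI)
  fix K assume K: "compact K \<and> K \<subseteq> {x. - x \<in> U}"
  then have "set_integrable lborel (uminus ` K) f"
    using assms compact_negations unfolding locally_integrable_def by blast
  then have "integrable lborel (\<lambda>x. indicator (uminus ` K) (0 + (-1) * x) *\<^sub>R f (0 + (-1) * x))"
    unfolding set_integrable_def by (subst lborel_integrable_real_affine_iff) auto
  moreover have "indicator (uminus ` K) (- x) = (indicator K x :: real)" for x
    by (auto split: split_indicator)
  ultimately show "set_integrable lborel K (\<lambda>x. f (- x))" by (simp add: set_integrable_def)
qed

lemma test_fun_reflect:
  assumes "test_fun {x. - x \<in> U} \<phi>"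
  shows "test_fun U (\<lambda>x. \<phi> (- x))" "deriv (\<lambda>x. \<phi> (- x)) x = - deriv \<phi> (- x)"
proof -
  have s: "smooth \<phi>" using assms by (simp add: test_fun_def smooth_def)
  have s': "smooth (\<lambda>x. \<phi> (- x))" using smooth_affine[OF s, of 1 "-1" 0] by simp
  let ?K = "uminus ` closure {x. \<phi> x \<noteq> 0}"
  have K: "compact ?K" "?K \<subseteq> U"
    using assms compact_negations[of "closure {x. \<phi> x \<noteq> 0}"] unfolding test_fun_def by auto
  have "{x. \<phi> (- x) \<noteq> 0} \<subseteq> ?K"
  proof
    fix x assume "x \<in> {x. \<phi> (- x) \<noteq> 0}"
    then have "- x \<in> closure {x. \<phi> x \<noteq> 0}" using closure_subset[of "{x. \<phi> x \<noteq> 0}"] by auto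
    then show "x \<in> ?K" by (rule rev_image_eqI) simp
  qed
  then have cK: "closure {x. \<phi> (- x) \<noteq> 0} \<subseteq> ?K"
    by (intro closure_minimal compact_imp_closed K)
  then have "compact (closure {x. \<phi> (- x) \<noteq> 0})"
    using compact_Int_closed[OF K(1) closed_closure[of "{x. \<phi> (- x) \<noteq> 0}"]] by (simp add: Int_absorb1 del: compact_closure)
  then show "test_fun U (\<lambda>x. \<phi> (- x))"
    using s' order_trans[OF cK K(2)] unfolding test_fun_def smooth_def by simp
  show "deriv (\<lambda>x. \<phi> (- x)) x = - deriv \<phi> (- x)"
    using DERIV_chain2[OF smooth_has_deriv[OF s] DERIV_minus[OF DERIV_ident]]
    by (intro DERIV_imp_deriv) simp
qed

lemma weak_deriv_reflect:
  assumes "weak_deriv U f g"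
  shows "weak_deriv {x. - x \<in> U} (\<lambda>x. f (- x)) (\<lambda>x. - g (- x))"
proof -
  have "locally_integrable {x. - x \<in> U} (\<lambda>x. - g (- x))"
    using locally_integrable_reflect[of U g] assms
    by (simp add: weak_deriv_def locally_integrable_def set_integrable_def)
  moreover have "(LINT x:{x. - x \<in> U}|lborel. f (- x) * deriv \<phi> x) = - (LINT x:{x. - x \<in> U}|lborel. - g (- x) * \<phi> x)"
    if \<phi>: "test_fun {x. - x \<in> U} \<phi>" for \<phi>
  proof -
    have "(LINT x:U|lborel. f x * deriv (\<lambda>x. \<phi> (- x)) x) = - (LINT x:U|lborel. g x * \<phi> (- x))"
      using assms test_fun_reflect(1)[OF \<phi>] unfolding weak_deriv_def by blast
    then have "(LINT x:U|lborel. f x * deriv \<phi> (- x)) = (LINT x:U|lborel. g x * \<phi> (- x))"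
      by (simp add: test_fun_reflect(2)[OF \<phi>] set_lebesgue_integral_def)
    then show ?thesis
      unfolding set_integral_reflect[of U] by (simp add: set_lebesgue_integral_def)
  qed
  ultimately show ?thesis
    using assms locally_integrable_reflect unfolding weak_deriv_def by blast
qed

lemma weak_deriv_uminus:
  "weak_deriv U f g \<Longrightarrow> weak_deriv U (\<lambda>x. - f x) (\<lambda>x. - g x)"
  by (simp add: weak_deriv_def locally_integrable_def set_integrable_def set_lebesgue_integral_def)

text \<open>A negative extremal slope becomes positive for x \<mapsto> v(-x) on (-b,-a). Under this
  reflection the first and third derivatives change sign and the second does not; the sign of
  \<open>w\<close> disappears in the square.\<close>

lemma max_slope_bound:
  fixes a b n \<epsilon> x1 :: real and v d g h w :: "real \<Rightarrow> real"
  assumes ab: "a < b" and \<epsilon>: "0 < \<epsilon>" "\<epsilon> \<le> 1/2" and n: "n < 3"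
    and v: "\<And>x. x \<in> {a..b} \<Longrightarrow> (v has_real_derivative d x) (at x within {a..b})"
    and d: "continuous_on {a..b} d" "d a = 0" "d b = 0"
    and nonneg: "\<And>x. x \<in> {a..b} \<Longrightarrow> 0 \<le> v x" and mass: "(LINT x:{a<..<b}|lborel. v x) = 1"
    and gd: "AE x in lborel. x \<in> {a<..<b} \<longrightarrow> g x = d x"
    and wd: "weak_deriv (pos_set a b v) g h" "weak_deriv (pos_set a b v) h w"
    and x1: "x1 \<in> {a..b}" "\<And>x. x \<in> {a..b} \<Longrightarrow> \<bar>d x\<bar> \<le> \<bar>d x1\<bar>"
  shows "ennreal (d x1 ^ 4) \<le> ennreal (slope_const n (b - a)) *
      (\<integral>\<^sup>+x\<in>pos_set a b v. ennreal (\<bar>ln \<epsilon>\<bar> * mobility n \<epsilon> (v x) * (w x)\<^sup>2) \<partial>lborel)"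
proof -
  let ?f = "\<lambda>x. ennreal (\<bar>ln \<epsilon>\<bar> * mobility n \<epsilon> (v x) * (w x)\<^sup>2)"
  have "\<exists>\<alpha> \<beta>. {\<alpha>..\<beta>} \<subseteq> pos_set a b v \<and>
      ennreal (d x1 ^ 4) \<le> ennreal (slope_const n (b - a)) * (\<integral>\<^sup>+x\<in>{\<alpha>..\<beta>}. ?f x \<partial>lborel)"
  proof (cases "d x1 \<ge> 0")
    case True
    then show ?thesis
      using max_slope_bound_pos[OF ab \<epsilon> n v d nonneg mass gd wd x1(1)] x1(2) by simp
  next
    case False
    define v' where "v' x = v (- x)" for x
    define d' where "d' x = - d (- x)" for x
    have P: "pos_set (- b) (- a) v' = {x. - x \<in> pos_set a b v}" by (auto simp: pos_set_def v'_def)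
    have "\<exists>\<alpha> \<beta>. {\<alpha>..\<beta>} \<subseteq> pos_set (- b) (- a) v' \<and> ennreal (d' (- x1) ^ 4) \<le> ennreal (slope_const n (- a - - b)) *
      (\<integral>\<^sup>+x\<in>{\<alpha>..\<beta>}. ennreal (\<bar>ln \<epsilon>\<bar> * mobility n \<epsilon> (v' x) * (- w (- x))\<^sup>2) \<partial>lborel)"
    proof (rule max_slope_bound_pos[where d = d' and g = "\<lambda>x. - g (- x)" and h = "\<lambda>x. h (- x)"])
      show "(v' has_real_derivative d' x) (at x within {- b..- a})" if x: "x \<in> {- b..- a}" for x
      proof -
        have im: "uminus ` {- b..- a} = {a..b}" by simp
        have "(v \<circ> uminus has_real_derivative d (- x) * - 1) (at x within {- b..- a})"
          by (rule DERIV_image_chain) (use v[of "- x"] x in \<open>auto simp: im intro!: derivative_eq_intros\<close>)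
        then show ?thesis by (simp add: v'_def[abs_def] d'_def comp_def)
      qed
      show "continuous_on {- b..- a} d'"
        unfolding d'_def[abs_def] by (intro continuous_intros continuous_on_compose2[OF d(1)]) auto
      show "(LINT x:{- b<..<- a}|lborel. v' x) = 1"
        using mass unfolding set_integral_reflect[of "{a<..<b}"]
        by (simp add: v'_def set_lebesgue_integral_def indicator_def minus_less_iff less_minus_iff conj_commute)
      show "AE x in lborel. x \<in> {- b<..<- a} \<longrightarrow> - g (- x) = d' x"
      proof -
        have "AE x in distr lborel borel (uminus :: real \<Rightarrow> real). x \<in> {a<..<b} \<longrightarrow> g x = d x"
          by (subst lborel_distr_uminus) (rule gd)
        then have "AE x in lborel. - x \<in> {a<..<b} \<longrightarrow> g (- x) = d (- x)"
          by (rule AE_distrD[rotated]) simp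
        then show ?thesis by (rule eventually_mono) (auto simp: d'_def)
      qed
      show "weak_deriv (pos_set (- b) (- a) v') (\<lambda>x. - g (- x)) (\<lambda>x. h (- x))"
        using weak_deriv_uminus[OF weak_deriv_reflect[OF wd(1)]] unfolding P by simp
      show "weak_deriv (pos_set (- b) (- a) v') (\<lambda>x. h (- x)) (\<lambda>x. - w (- x))"
        using weak_deriv_reflect[OF wd(2)] unfolding P .
      show "\<bar>d' x\<bar> \<le> d' (- x1)" if "x \<in> {- b..- a}" for x
        using x1(2)[of "- x"] that False by (simp add: d'_def)
    qed (use ab \<epsilon> n d nonneg x1 in \<open>auto simp: v'_def d'_def\<close>)
    then obtain \<alpha> \<beta> where s: "{\<alpha>..\<beta>} \<subseteq> {x. - x \<in> pos_set a b v}"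
      and le: "ennreal (d x1 ^ 4) \<le> ennreal (slope_const n (b - a)) *
        (\<integral>\<^sup>+x\<in>{\<alpha>..\<beta>}. ennreal (\<bar>ln \<epsilon>\<bar> * mobility n \<epsilon> (v (- x)) * (w (- x))\<^sup>2) \<partial>lborel)"
      unfolding P by (auto simp: v'_def d'_def)
    have sub: "{- \<beta>..- \<alpha>} \<subseteq> pos_set a b v"
    proof
      fix x assume "x \<in> {- \<beta>..- \<alpha>}"
      then have "- x \<in> {\<alpha>..\<beta>}" by simp
      with s show "x \<in> pos_set a b v" by fastforce
    qed
    have "(\<integral>\<^sup>+x\<in>{- \<beta>..- \<alpha>}. ?f x \<partial>lborel) =
        (\<integral>\<^sup>+x\<in>{\<alpha>..\<beta>}. ennreal (\<bar>ln \<epsilon>\<bar> * mobility n \<epsilon> (v (- x)) * (w (- x))\<^sup>2) \<partial>lborel)"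
    proof -
      let ?I = "{- \<beta>..- \<alpha>}"
      have "continuous_on {a..b} v" using v by (rule DERIV_continuous_on)
      moreover have "?I \<subseteq> {a..b}" using sub by (force simp: pos_set_def)
      ultimately have "continuous_on ?I (\<lambda>x. mobility n \<epsilon> (v x))"
        using sub by (intro continuous_on_mobility) (auto intro: continuous_on_subset simp: pos_set_def)
      then have [measurable]: "(\<lambda>x. indicator ?I x *\<^sub>R mobility n \<epsilon> (v x)) \<in> borel_measurable borel"
        by (intro borel_measurable_continuous_on_indicator) auto
      have [measurable]: "(\<lambda>x. indicator ?I x *\<^sub>R w x) \<in> borel_measurable borel"
        using weak_deriv_integrable(2)[OF wd(2) sub] by (auto simp: set_integrable_def)
      \<comment> \<open>The change of variables requires a measurable integrand. It is assembled
        from \<open>w\<close> and the mobility, both cut off to the compact interval.\<close>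
      have "(\<lambda>x. ?f x * indicator ?I x) =
          (\<lambda>x. ennreal (\<bar>ln \<epsilon>\<bar> * (indicator ?I x *\<^sub>R mobility n \<epsilon> (v x)) * (indicator ?I x *\<^sub>R w x)\<^sup>2))"
        by (auto simp: fun_eq_iff split: split_indicator)
      moreover have "\<dots> \<in> borel_measurable borel" by measurable
      ultimately have "(\<lambda>x. ?f x * indicator ?I x) \<in> borel_measurable borel" by (simp only:)
      then have "(\<integral>\<^sup>+x\<in>?I. ?f x \<partial>lborel) = (\<integral>\<^sup>+x. ?f (0 + (-1) * x) * indicator ?I (0 + (-1) * x) \<partial>lborel)"
        by (subst nn_integral_real_affine[where c = "-1" and t = 0]) auto
      moreover have "indicator ?I (- x) = (indicator {\<alpha>..\<beta>} x :: ennreal)" for x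
        by (auto split: split_indicator)
      ultimately show ?thesis by simp
    qed
    with le sub show ?thesis by (intro exI[of _ "- \<beta>"] exI[of _ "- \<alpha>"]) simp
  qed
  then obtain \<alpha> \<beta> where "{\<alpha>..\<beta>} \<subseteq> pos_set a b v"
    and le: "ennreal (d x1 ^ 4) \<le> ennreal (slope_const n (b - a)) * (\<integral>\<^sup>+x\<in>{\<alpha>..\<beta>}. ?f x \<partial>lborel)" by blast
  then have "(\<integral>\<^sup>+x\<in>{\<alpha>..\<beta>}. ?f x \<partial>lborel) \<le> (\<integral>\<^sup>+x\<in>pos_set a b v. ?f x \<partial>lborel)"
    by (intro nn_integral_mono) (auto split: split_indicator)
  then show ?thesis using le by (meson mult_left_mono order_trans zero_le)
qed

lemma slope_const_pos: "n < 3 \<Longrightarrow> l > 0 \<Longrightarrow> slope_const n l > 0"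
  unfolding slope_const_def by (intro add_pos_pos mult_pos_pos divide_pos_pos) auto

section \<open>Integration in time\<close>

text \<open>Neither \<open>G\<close> nor \<open>H\<close> is assumed measurable, so monotone convergence is applied to the simple
  functions below \<open>H\<close> instead.\<close>

lemma nn_integral_le_of_truncations:
  fixes H G :: "real \<Rightarrow> ennreal"
  assumes HG: "AE t in lborel. t > 0 \<longrightarrow> H t \<le> ennreal C * G t" and C: "C > 0"
    and E: "\<And>T. T > 0 \<Longrightarrow> (\<integral>\<^sup>+t\<in>{0<..<T}. G t \<partial>lborel) \<le> E"
  shows "(\<integral>\<^sup>+t\<in>{0<..}. H t \<partial>lborel) \<le> ennreal C * E"
  unfolding nn_integral_def
proof (rule SUP_least, clarify)
  fix s :: "real \<Rightarrow> ennreal"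
  assume s: "simple_function lborel s" "s \<le> (\<lambda>t. H t * indicator {0<..} t)"
  have [measurable]: "s \<in> borel_measurable lborel" using s(1) by (rule borel_measurable_simple_function)
  \<comment> \<open>The factor \<open>C\<close> is pulled out of the integral of the measurable
    \<open>f k\<close> by means of 1/C, rather than out of the integral of \<open>G\<close>.\<close>
  have C1: "ennreal C * ennreal (1 / C) = 1" using C by (simp add: ennreal_mult[symmetric])
  \<comment> \<open>\<open>Suc k\<close> keeps the time horizon positive, as the bound by
    \<open>E\<close> requires.\<close>
  define f where "f k t = s t * indicator {0<..<real (Suc k)} t" for k t
  have [measurable]: "f k \<in> borel_measurable lborel" for k unfolding f_def[abs_def] by measurable
  have sup: "s t = (SUP k. f k t)" for t
  proof (cases "t > 0")
    case True
    obtain k :: nat where "t < real k" using reals_Archimedean2 by blast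
    then have "f k t = s t" using True by (simp add: f_def)
    then show ?thesis
      by (intro antisym SUP_least) (auto simp: f_def split: split_indicator intro!: SUP_upper2[of k])
  next
    case False
    then have "s t \<le> 0" using s(2)[THEN le_funD, of t] by simp
    then show ?thesis by (simp add: f_def)
  qed
  have "(\<integral>\<^sup>+t. f k t \<partial>lborel) \<le> ennreal C * E" for k
  proof -
    have "(\<integral>\<^sup>+t. f k t \<partial>lborel) = ennreal C * (\<integral>\<^sup>+t. ennreal (1 / C) * f k t \<partial>lborel)"
      by (simp add: nn_integral_cmult mult.assoc[symmetric] C1)
    also have "(\<integral>\<^sup>+t. ennreal (1 / C) * f k t \<partial>lborel) \<le> (\<integral>\<^sup>+t\<in>{0<..<real (Suc k)}. G t \<partial>lborel)"
    proof (rule nn_integral_mono_AE, use HG in eventually_elim)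
      case (elim t)
      show ?case
      proof (cases "t \<in> {0<..<real (Suc k)}")
        case True
        then have "s t \<le> ennreal C * G t" using s(2)[THEN le_funD, of t] elim by simp
        then have "ennreal (1 / C) * s t \<le> ennreal (1 / C) * (ennreal C * G t)" by (rule mult_left_mono) simp
        also have "\<dots> = G t" using C1 by (simp add: mult.assoc[symmetric] mult.commute)
        finally show ?thesis using True by (simp add: f_def)
      qed (simp add: f_def)
    qed
    also have "\<dots> \<le> E" by (rule E) simp
    finally show ?thesis by (simp add: mult_left_mono)
  qed
  moreover have "integral\<^sup>S lborel s = (SUP k. \<integral>\<^sup>+t. f k t \<partial>lborel)"
  proof -
    have "incseq f" by (auto simp: f_def incseq_def le_fun_def split: split_indicator)
    then have "(\<integral>\<^sup>+t. (SUP k. f k t) \<partial>lborel) = (SUP k. \<integral>\<^sup>+t. f k t \<partial>lborel)"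
      by (rule nn_integral_monotone_convergence_SUP) measurable
    moreover have "s = (\<lambda>t. SUP k. f k t)" using sup by (rule ext)
    ultimately show ?thesis using nn_integral_eq_simple_integral[OF s(1)] by simp
  qed
  ultimately show "integral\<^sup>S lborel s \<le> ennreal C * E" by (simp add: SUP_least)
qed


text \<open>For almost every time the representative \<open>ux t\<close> agrees almost everywhere
  with the continuous classical slope, whose absolute maximum is attained and bounds the essential
  supremum. The slice estimate applies at that maximum.\<close>

lemma esssup_slope_bound:
  fixes u ux uxx uxxx :: "real \<Rightarrow> real \<Rightarrow> real"
  assumes ab: "a < b" and n: "n < 3" and \<epsilon>: "\<epsilon> \<in> {0<..1/2}"
    and mass: "(LINT x:{a<..<b}|lborel. u_in x) = 1"
    and sol: "thin_film_solution n a b \<epsilon> u_in du_in u ux uxx uxxx"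
  shows "AE t in lborel. t > 0 \<longrightarrow>
    (esssup (restrict_space lborel {a<..<b}) (\<lambda>x. ennreal \<bar>ux t x\<bar>)) ^ 4 \<le> ennreal (slope_const n (b - a)) *
      (\<integral>\<^sup>+x\<in>pos_set a b (u t). ennreal (\<bar>ln \<epsilon>\<bar> * mobility n \<epsilon> (u t x) * (uxxx t x)\<^sup>2) \<partial>lborel)"
proof -
  have C1: "AE t in lborel. t > 0 \<longrightarrow> C1_Neumann a b (u t)"
    and D: "AE t in lborel. t > 0 \<longrightarrow> weak_deriv (pos_set a b (u t)) (ux t) (uxx t) \<and>
        weak_deriv (pos_set a b (u t)) (uxx t) (uxxx t)"
    and ux: "\<And>t. t > 0 \<Longrightarrow> weak_deriv {a<..<b} (u t) (ux t)"
    and meas: "st_measurable {0<..} {a<..<b} ux"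
    and nonneg: "\<And>t x. t > 0 \<Longrightarrow> x \<in> {a..b} \<Longrightarrow> 0 \<le> u t x"
    and ut: "\<And>t. t > 0 \<Longrightarrow> (LINT x:{a<..<b}|lborel. u t x) = 1"
    using sol mass unfolding thin_film_solution_def x_derivatives_def weak_solution_def by auto
  from C1 D show ?thesis
  proof eventually_elim
    case (elim t)
    show ?case
    proof
      assume t: "t > 0"
      obtain d where d: "continuous_on {a..b} d" "d a = 0" "d b = 0"
        "\<And>x. x \<in> {a..b} \<Longrightarrow> (u t has_real_derivative d x) (at x within {a..b})"
        using elim t unfolding C1_Neumann_def by blast
      have gd: "AE x in lborel. x \<in> {a<..<b} \<longrightarrow> ux t x = d x"
        by (rule weak_deriv_AE_eq[OF ux[OF t] d(4,1)])
      obtain x1 where x1: "x1 \<in> {a..b}" "\<And>x. x \<in> {a..b} \<Longrightarrow> \<bar>d x\<bar> \<le> \<bar>d x1\<bar>"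
        using continuous_attains_sup[of "{a..b}" "\<lambda>x. \<bar>d x\<bar>"] ab d(1) by (force intro: continuous_intros)
      have "esssup (restrict_space lborel {a<..<b}) (\<lambda>x. ennreal \<bar>ux t x\<bar>) \<le> ennreal \<bar>d x1\<bar>"
      proof (rule esssup_I)
        have "(\<lambda>x. (t, x)) \<in> measurable (restrict_space lborel {a<..<b}) (restrict_space borel ({0<..} \<times> {a<..<b}))"
          using t by (intro measurable_restrict_space3) auto
        from measurable_compose[OF this meas[unfolded st_measurable_def]]
        have "ux t \<in> borel_measurable (restrict_space lborel {a<..<b})" by simp
        then show "(\<lambda>x. ennreal \<bar>ux t x\<bar>) \<in> borel_measurable (restrict_space lborel {a<..<b})" by measurable
        show "AE x in restrict_space lborel {a<..<b}. ennreal \<bar>ux t x\<bar> \<le> ennreal \<bar>d x1\<bar>"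
          using gd by (subst AE_restrict_space_iff) (auto elim!: eventually_mono intro!: ennreal_leI x1(2))
      qed
      then have "esssup (restrict_space lborel {a<..<b}) (\<lambda>x. ennreal \<bar>ux t x\<bar>) ^ 4 \<le> ennreal \<bar>d x1\<bar> ^ 4"
        by (rule power_mono) simp
      also have "\<dots> = ennreal (d x1 ^ 4)" by (simp add: ennreal_power)
      also have "\<dots> \<le> ennreal (slope_const n (b - a)) *
          (\<integral>\<^sup>+x\<in>pos_set a b (u t). ennreal (\<bar>ln \<epsilon>\<bar> * mobility n \<epsilon> (u t x) * (uxxx t x)\<^sup>2) \<partial>lborel)"
        using elim t \<epsilon> by (intro max_slope_bound[OF ab _ _ n d(4,1,2,3) nonneg[OF t] ut[OF t] gd _ _ x1]) auto
      finally show "(esssup (restrict_space lborel {a<..<b}) (\<lambda>x. ennreal \<bar>ux t x\<bar>)) ^ 4 \<le> ennreal (slope_const n (b - a)) *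
          (\<integral>\<^sup>+x\<in>pos_set a b (u t). ennreal (\<bar>ln \<epsilon>\<bar> * mobility n \<epsilon> (u t x) * (uxxx t x)\<^sup>2) \<partial>lborel)" .
    qed
  qed
qed

theorem proposition1p3:
  fixes a b n :: real
    and u_in du_in :: "real \<Rightarrow> real"
    and u ux uxx uxxx :: "real \<Rightarrow> real \<Rightarrow> real \<Rightarrow> real"
  assumes "a < b" and "0 < n" and "n < 3"
    and "H1_with_deriv {a<..<b} u_in du_in"
    and "AE x in lborel. x \<in> {a<..<b} \<longrightarrow> u_in x \<ge> 0"
    and "(LINT x:{a<..<b}|lborel. u_in x) = 1"
    and "\<And>\<epsilon>. \<epsilon> \<in> {0<..1/2} \<Longrightarrow>
           thin_film_solution n a b \<epsilon> u_in du_in (u \<epsilon>) (ux \<epsilon>) (uxx \<epsilon>) (uxxx \<epsilon>)"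
  shows "\<exists>C::real. \<forall>\<epsilon>\<in>{0<..1/2}. L4_Linf_norm {a<..<b} (ux \<epsilon>) \<le> ennreal C"
proof -
  define C where "C = slope_const n (b - a)"
  have C: "C > 0" unfolding C_def using assms(1,3) by (intro slope_const_pos) auto
  \<comment> \<open>The initial energy, finite and independent of \<epsilon>, bounds the dissipation
    up to every time.\<close>
  define E where "E = ennreal (1/2) * L2_sq {a<..<b} du_in"
  have "L2_sq {a<..<b} du_in < top" using assms(4) by (simp add: H1_with_deriv_def)
  then have "E < top"
    unfolding E_def ennreal_mult_less_top using ennreal_less_top[of "1/2"] by blast
  then obtain e where e: "E = ennreal e" "e \<ge> 0" by (cases E) auto
  show ?thesis
  proof (intro exI ballI)
    fix \<epsilon> :: real assume \<epsilon>: "\<epsilon> \<in> {0<..1/2}"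
    note sol = assms(7)[OF \<epsilon>]
    let ?I = "\<integral>\<^sup>+t\<in>{0<..}. (esssup (restrict_space lborel {a<..<b}) (\<lambda>x. ennreal \<bar>ux \<epsilon> t x\<bar>)) ^ 4 \<partial>lborel"
    have "?I \<le> ennreal C * E"
    proof (rule nn_integral_le_of_truncations[OF _ C])
      show "AE t in lborel. t > 0 \<longrightarrow>
        (esssup (restrict_space lborel {a<..<b}) (\<lambda>x. ennreal \<bar>ux \<epsilon> t x\<bar>)) ^ 4 \<le> ennreal C *
          (\<integral>\<^sup>+x\<in>pos_set a b (u \<epsilon> t). ennreal (\<bar>ln \<epsilon>\<bar> * mobility n \<epsilon> (u \<epsilon> t x) * (uxxx \<epsilon> t x)\<^sup>2) \<partial>lborel)"
        unfolding C_def by (rule esssup_slope_bound[OF assms(1,3) \<epsilon> assms(6) sol])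
      fix T :: real assume "T > 0"
      then have "ennreal (1/2) * L2_sq {a<..<b} (ux \<epsilon> T) + (\<integral>\<^sup>+t\<in>{0<..<T}.
          (\<integral>\<^sup>+x\<in>pos_set a b (u \<epsilon> t). ennreal (\<bar>ln \<epsilon>\<bar> * mobility n \<epsilon> (u \<epsilon> t x) * (uxxx \<epsilon> t x)\<^sup>2) \<partial>lborel) \<partial>lborel) \<le> E"
        using sol unfolding thin_film_solution_def E_def by blast
      then show "(\<integral>\<^sup>+t\<in>{0<..<T}.
          (\<integral>\<^sup>+x\<in>pos_set a b (u \<epsilon> t). ennreal (\<bar>ln \<epsilon>\<bar> * mobility n \<epsilon> (u \<epsilon> t x) * (uxxx \<epsilon> t x)\<^sup>2) \<partial>lborel) \<partial>lborel) \<le> E"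
        by (rule order_trans[rotated]) simp
    qed
    then have I: "?I \<le> ennreal (C * e)" using C e by (simp add: ennreal_mult)
    \<comment> \<open>Finiteness selects the branch of \<open>L4_Linf_norm\<close> given by the
      fourth root.\<close>
    then have "?I < \<infinity>" by (simp add: le_less_trans)
    moreover have "enn2real ?I \<le> C * e" using I C e by (intro enn2real_leI) auto
    ultimately show "L4_Linf_norm {a<..<b} (ux \<epsilon>) \<le> ennreal (root 4 (C * e))"
      unfolding L4_Linf_norm_def Let_def by (auto intro!: ennreal_leI)
  qed
qed

end
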